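(* Let $k$ and $n$ be positive integers. (i) Let $p$ be a prime with $p \equiv 2 \pmod 3$, and let $r$ be a non-negative integer with $p \mid 3r+2$. Then $$B_{3,7}\left(p^{k+1}n+pr+ \frac{2p-1}{3}\right)\equiv -\left(\frac{-7}{p}\right)_{L} B_{3,7}\left(p^{k-1}n+ \frac{3r+2-p}{3p} \right) \pmod3.$$ (ii) Let $p$ be a prime with $p \equiv 3 \pmod 4$, and let $r$ be a non-negative integer with $p \mid 4r+3$. Then $$B_{3,5}\left(p^{k+1}n+pr+ \frac{3p-1}{4}\right)\equiv -\left(\frac{-5}{p}\right)_{L} B_{3,5}\left(p^{k-1}n+ \frac{4r+3-p}{4p} \right) \pmod3.$$ (iii) Let $t \in \{3,5,7\}$, let $p$ be a prime with $p \equiv t \pmod 8$, and let $r$ be a non-negative integer with $p\mid 8r+t$. Then $$B_{3,2}\left(p^{k+1}n+pr+ \frac{tp-1}{8}\right)\equiv -\left(\frac{-2}{p}\right)_{L} B_{3,2}\left(p^{k-1}n+ \frac{8r+t-p}{8p} \right) \pmod3.$$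
   Context: For integers $u,v\ge 2$, $B_{u,v}(n)$ is the number of bipartitions $(\alpha,\beta)$ of $n$ with $\alpha$ having no part divisible by $u$ and $\beta$ having no part divisible by $v$; $B_{u,v}(0)=1$ and $\sum_{n\ge0}B_{u,v}(n)q^n=\frac{f_uf_v}{f_1^2}$, $f_t=\prod_{k\ge1}(1-q^{tk})$. For an odd prime $p$, $\left(\frac{a}{p}\right)_L$ is the Legendre symbol (equal to $0$ if $p\mid a$); for $p=2$ it is understood as the Kronecker symbol. *)

theory Defs
  imports "HOL-Library.Multiset" "HOL-Number_Theory.Number_Theory"
begin

text \<open>A partition is represented by the multiset of its (positive) parts.\<close>

definition partition_of :: "nat multiset \<Rightarrow> nat \<Rightarrow> bool" where
  "partition_of \<alpha> n \<longleftrightarrow> (\<forall>x\<in>#\<alpha>. 0 < x) \<and> sum_mset \<alpha> = n"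

definition regular :: "nat \<Rightarrow> nat multiset \<Rightarrow> bool" where
  "regular u \<alpha> \<longleftrightarrow> (\<forall>x\<in>#\<alpha>. \<not> u dvd x)"

definition B :: "nat \<Rightarrow> nat \<Rightarrow> nat \<Rightarrow> nat" where
  "B u v n = card {(\<alpha>, \<beta>). (\<exists>i j. partition_of \<alpha> i \<and> partition_of \<beta> j \<and> i + j = n)
                             \<and> regular u \<alpha> \<and> regular v \<beta>}"

text \<open>The Kronecker symbol for a prime lower argument \<open>p\<close> only. The case \<open>p = 2\<close> is separate
  because the library's \<open>Legendre a 2\<close> is 1 for every odd \<open>a\<close>.\<close>

definition Kronecker :: "int \<Rightarrow> nat \<Rightarrow> int" where
  "Kronecker a p =
     (if p = 2 then (if even a then 0 else if a mod 8 \<in> {1, 7} then 1 else -1)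
      else Legendre a (int p))"

end

theory Submission
  imports Defs "HOL-Library.Discrete_Functions" "HOL-Computational_Algebra.Formal_Power_Series"
begin

text \<open>
  Since (1 - q)^3 = 1 - q^3 modulo 3, the generating function of B 3 v is congruent to f_1 f_v.
  Euler's pentagonal number theorem turns its n-th coefficient into a sum of chi(x) chi(y), with chi
  the quadratic character modulo 12, over the solutions of x^2 + v y^2 = 24 n + 1 + v. This sum is
  multiplied by -(-v/p) when 24 n + 1 + v is multiplied by p^2. If p is inert in Q(sqrt (-v)), then p
  divides both x and y. If p splits, every x + y sqrt (-v) of norm divisible by p^2 is a multiple of
  one of the two conjugate elements of norm p (of norm 2 p if v = 5). The two families of multiples
  cancel, and what remains is their intersection, counted with the opposite sign: the multiples of p.
  The split primes 2 and 3 divide the modulus of chi and need an explicit substitution instead.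
\<close>

subsection \<open>The pentagonal number theorem\<close>

text \<open>The congruence on \<open>p\<close> enters through the cancellation. For a split
  \<open>p\<close> the products to be compared, \<open>(a * c - v * b * d) * (a * d + b * c)\<close>
  and its conjugate, have sum 2cd(a^2 - v b^2) and difference 2ab(c^2 - v d^2). As chi is a product
  of odd characters modulo 3 and 4, it changes sign once 3 divides one of these numbers and 4 the
  other. The norm 2 p for v = 5 reflects the class group of Q(sqrt(-5)), of order two: odd values of
  x^2 + 5 y^2 are 1 modulo 4, so p = 3 modulo 4 is never one of them. For the split primes 2 and 3
  the intersection has weight zero, so cancellation cannot produce the answer; a bijection of
  solutions that reverses chi replaces it. The three cases share one computation because v + 1 = 8,
  6, 3 divides 24 and the modulus 3, 4, 8 for \<open>p\<close> is the cofactor.\<close>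

text \<open>The terms of Shanks' finite form of the pentagonal number theorem.\<close>

definition shanks_term :: "'a::comm_ring_1 \<Rightarrow> nat \<Rightarrow> nat \<Rightarrow> 'a" where
  "shanks_term q n k = (-1) ^ k * (\<Prod>i\<in>{k<..n}. 1 - q ^ i) * q ^ (k * n + k * (k + 1) div 2)"

text \<open>Generalized pentagonal numbers, with \<open>m\<close> over all integers. The sign in
  \<open>3 * m + 1\<close> makes \<open>24 * pent m + 1\<close> the square of
  \<open>6 * m + 1\<close>.\<close>

definition pent :: "int \<Rightarrow> nat" where
  "pent m = nat (m * (3 * m + 1) div 2)"

lemma pent_double: "2 * int (pent m) = m * (3 * m + 1)"
proof -
  have "even (m * (3 * m + 1))" by simp
  moreover have "m * (3 * m + 1) \<ge> 0"
    by (cases "m \<ge> 0") (auto intro: mult_nonpos_nonpos)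
  ultimately show ?thesis unfolding pent_def by auto
qed

lemma triangle_Suc: "Suc k * (Suc k + 1) div 2 = k * (k + 1) div 2 + Suc k"
  by simp

lemma prod_greaterThanAtMost_Suc:
  fixes f :: "nat \<Rightarrow> 'a::comm_monoid_mult"
  assumes "k \<le> n"
  shows "(\<Prod>i\<in>{k<..Suc n}. f i) = (\<Prod>i\<in>{k<..n}. f i) * f (Suc n)"
proof -
  have "{k<..Suc n} = insert (Suc n) {k<..n}" using assms by auto
  then show ?thesis by (simp add: mult.commute)
qed

lemma prod_greaterThanAtMost_rec:
  fixes f :: "nat \<Rightarrow> 'a::comm_monoid_mult"
  assumes "k < n"
  shows "(\<Prod>i\<in>{k<..n}. f i) = f (Suc k) * (\<Prod>i\<in>{Suc k<..n}. f i)"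
proof -
  have "{k<..n} = insert (Suc k) {Suc k<..n}" using assms by auto
  then show ?thesis by simp
qed

text \<open>The change in the terms when \<open>n\<close> grows by one telescopes. At
  \<open>j = n\<close> the product is empty and only the monomial for \<open>m = -(n + 1)\<close> is
  left.\<close>

lemma shanks_partial:
  fixes q :: "'a::comm_ring_1"
  assumes "j \<le> n"
  shows "(\<Sum>k\<le>j. shanks_term q (Suc n) k - shanks_term q n k) =
    - ((-1) ^ j * (\<Prod>i\<in>{j<..n}. 1 - q ^ i) * q ^ (Suc j * Suc n + j * (j + 1) div 2))"
  using assms
proof (induction j)
  case 0
  show ?case by (simp add: shanks_term_def prod_greaterThanAtMost_Suc algebra_simps)
next
  case (Suc j)
  define t where "t = j * (j + 1) div 2"
  define R where "R = (\<Prod>i\<in>{Suc j<..n}. 1 - q ^ i)"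
  have t: "Suc j * (Suc j + 1) div 2 = t + Suc j"
    unfolding t_def by (rule triangle_Suc)
  have R1: "(\<Prod>i\<in>{Suc j<..Suc n}. 1 - q ^ i) = R * (1 - q ^ Suc n)"
    unfolding R_def using Suc.prems by (rule prod_greaterThanAtMost_Suc)
  have R2: "(\<Prod>i\<in>{j<..n}. 1 - q ^ i) = (1 - q ^ Suc j) * R"
    unfolding R_def using Suc.prems by (intro prod_greaterThanAtMost_rec) simp
  have IH: "(\<Sum>k\<le>j. shanks_term q (Suc n) k - shanks_term q n k) =
      - ((-1) ^ j * ((1 - q ^ Suc j) * R) * q ^ (Suc j * Suc n + t))"
    using Suc by (simp only: R2 t_def Suc_leD)
  show ?case
    unfolding sum.atMost_Suc IH
    unfolding shanks_term_def R1 t R_def[symmetric]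
    by (simp add: algebra_simps power_add)
qed

text \<open>From \<open>n\<close> to \<open>n + 1\<close> two monomials appear: the telescoped
  differences give the exponent \<open>pent (- int (Suc n))\<close>, the extra term
  \<open>k = n + 1\<close> gives \<open>pent (int (Suc n))\<close>.\<close>

theorem shanks_identity:
  fixes q :: "'a::comm_ring_1"
  shows "(\<Sum>k\<le>n. shanks_term q n k) = (\<Sum>m\<in>{-int n..int n}. (-1) ^ nat \<bar>m\<bar> * q ^ pent m)"
proof (induction n)
  case 0
  show ?case by (simp add: shanks_term_def pent_def)
next
  case (Suc n)
  have *: "{-int (Suc n)..int (Suc n)} = insert (- int (Suc n)) (insert (int (Suc n)) {-int n..int n})"
    by auto
  have e1: "pent (int (Suc n)) = Suc n * Suc n + Suc n * (Suc n + 1) div 2"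
  proof -
    have "2 * int (pent (int (Suc n))) = 2 * int (Suc n * Suc n) + int (Suc n * (Suc n + 1))"
      unfolding pent_double by (simp add: algebra_simps)
    moreover have "even (Suc n * (Suc n + 1))" by simp
    ultimately show ?thesis by presburger
  qed
  have e2: "pent (- int (Suc n)) = Suc n * Suc n + n * (n + 1) div 2"
  proof -
    have "2 * int (pent (- int (Suc n))) = 2 * int (Suc n * Suc n) + int (n * (n + 1))"
      unfolding pent_double by (simp add: algebra_simps)
    moreover have "even (n * (n + 1))" by simp
    ultimately show ?thesis by presburger
  qed
  have "(\<Sum>k\<le>Suc n. shanks_term q (Suc n) k) =
      (\<Sum>k\<le>n. shanks_term q n k) + (\<Sum>k\<le>n. shanks_term q (Suc n) k - shanks_term q n k)
        + shanks_term q (Suc n) (Suc n)"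
    by (simp add: sum_subtractf)
  also have "\<dots> = (\<Sum>m\<in>{-int n..int n}. (-1) ^ nat \<bar>m\<bar> * q ^ pent m)
       + (-1) ^ Suc n * q ^ pent (- int (Suc n)) + (-1) ^ Suc n * q ^ pent (int (Suc n))"
    unfolding Suc shanks_partial[OF order_refl] e1 e2
    unfolding shanks_term_def by simp
  also have "\<dots> = (\<Sum>m\<in>{-int (Suc n)..int (Suc n)}. (-1) ^ nat \<bar>m\<bar> * q ^ pent m)"
    unfolding * by (subst sum.insert; simp)+ (simp add: nat_add_distrib algebra_simps)
  finally show ?case .
qed

subsection \<open>Generating functions modulo 3\<close>

text \<open>Congruence modulo 3 and modulo q^(N+1) at once. The truncation lets finite products
  stand for the infinite f_t.\<close>

definition eqm :: "nat \<Rightarrow> int fps \<Rightarrow> int fps \<Rightarrow> bool" where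
  "eqm N a b \<longleftrightarrow> (\<forall>i\<le>N. [fps_nth a i = fps_nth b i] (mod 3))"

lemma eqm_refl [simp]: "eqm N a a"
  by (simp add: eqm_def)

lemma eqm_sym: "eqm N a b \<Longrightarrow> eqm N b a"
  by (auto simp: eqm_def cong_sym)

lemma eqm_trans [trans]: "eqm N a b \<Longrightarrow> eqm N b c \<Longrightarrow> eqm N a c"
  by (auto simp: eqm_def intro: cong_trans)

lemma eqm_mult: "eqm N a b \<Longrightarrow> eqm N c d \<Longrightarrow> eqm N (a * c) (b * d)"
  by (auto simp: eqm_def fps_mult_nth intro!: cong_sum cong_mult)

lemma eqm_prod: "(\<And>i. i \<in> I \<Longrightarrow> eqm N (f i) (g i)) \<Longrightarrow> eqm N (\<Prod>i\<in>I. f i) (\<Prod>i\<in>I. g i)"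
  by (induction I rule: infinite_finite_induct) (auto intro: eqm_mult)

lemma eqm_cancel:
  assumes "eqm N (u * a) (u * b)" and "w * u = 1"
  shows "eqm N a b"
proof -
  have "eqm N (w * (u * a)) (w * (u * b))"
    by (rule eqm_mult[OF eqm_refl assms(1)])
  moreover have "w * (u * c) = c" for c
    using assms(2) by (metis mult.assoc mult_1_left)
  ultimately show ?thesis by simp
qed

definition euler :: "nat \<Rightarrow> nat \<Rightarrow> int fps" where
  "euler t N = (\<Prod>k\<in>{1..N}. 1 - fps_X ^ (t * k))"

text \<open>Put q = X^t in Shanks' identity. The term \<open>k = 0\<close> is the Euler product;
  every other term has order at least t(kN + k(k+1)/2) > N and is invisible to
  \<open>eqm N\<close>.\<close>

lemma eqm_pentagonal:
  assumes "t > 0"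
  shows "eqm N (euler t N) (\<Sum>m\<in>{-int N..int N}. (-1) ^ nat \<bar>m\<bar> * fps_X ^ (t * pent m))"
proof -
  have z: "fps_nth (shanks_term (fps_X ^ t :: int fps) N k) i = 0" if "i \<le> N" "k > 0" for i k
  proof -
    have "N * 1 \<le> N * (t * k)" using assms that by (intro mult_le_mono2) (simp add: Suc_leI)
    moreover have "k * (k + 1) div 2 \<ge> 1" using that
      by (cases k) auto
    hence "t * (k * (k + 1) div 2) \<ge> 1" using assms by (simp add: Suc_le_eq)
    ultimately have "i < t * (k * N + k * (k + 1) div 2)" using that
      by (simp only: algebra_simps)
    then show ?thesis
      unfolding shanks_term_def power_mult[symmetric]
      by (simp add: fps_X_power_mult_right_nth)
  qed
  have "fps_nth (\<Sum>k\<le>N. shanks_term (fps_X ^ t :: int fps) N k) i = fps_nth (euler t N) i" if "i \<le> N" for i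
  proof -
    have "(\<Sum>k\<in>{1..N}. fps_nth (shanks_term (fps_X ^ t :: int fps) N k) i) = 0"
      using z[OF that] by (intro sum.neutral) auto
    moreover have "(\<Sum>k\<le>N. shanks_term (fps_X ^ t) N k) = shanks_term (fps_X ^ t :: int fps) N 0 + (\<Sum>k\<in>{1..N}. shanks_term (fps_X ^ t) N k)"
      by (simp add: atMost_atLeast0 sum.atLeast_Suc_atMost)
    moreover have "shanks_term (fps_X ^ t) N 0 = euler t N"
      unfolding shanks_term_def euler_def by (simp add: atLeastSucAtMost_greaterThanAtMost power_mult)
    ultimately show ?thesis by (simp add: fps_sum_nth)
  qed
  then show ?thesis
    unfolding shanks_identity by (auto simp: eqm_def power_mult)
qed

section \<open>Generating functions of partitions with parts in a finite set\<close>

definition parts_in :: "nat set \<Rightarrow> nat \<Rightarrow> nat multiset set" where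
  "parts_in S n = {\<alpha>. set_mset \<alpha> \<subseteq> S \<and> sum_mset \<alpha> = n}"

text \<open>Either \<open>k\<close> does not occur, or one copy of it can be removed. In the
  generating function this recursion is the factor \<open>1 - fps_X ^ k\<close>.\<close>

lemma parts_in_insert:
  assumes "k \<notin> S"
  shows "parts_in (insert k S) n =
    parts_in S n \<union> (if k \<le> n then add_mset k ` parts_in (insert k S) (n - k) else {})"
proof (intro equalityI subsetI)
  fix \<alpha> assume \<alpha>: "\<alpha> \<in> parts_in (insert k S) n"
  show "\<alpha> \<in> parts_in S n \<union> (if k \<le> n then add_mset k ` parts_in (insert k S) (n - k) else {})"
  proof (cases "k \<in># \<alpha>")
    case True
    then obtain \<beta> where "\<alpha> = add_mset k \<beta>" by (meson mset_add)
    with \<alpha> show ?thesis by (auto simp: parts_in_def)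
  next
    case False
    with \<alpha> show ?thesis by (auto simp: parts_in_def)
  qed
next
  fix \<alpha> assume "\<alpha> \<in> parts_in S n \<union> (if k \<le> n then add_mset k ` parts_in (insert k S) (n - k) else {})"
  then consider "\<alpha> \<in> parts_in S n"
    | \<beta> where "k \<le> n" "\<alpha> = add_mset k \<beta>" "\<beta> \<in> parts_in (insert k S) (n - k)"
    by (cases "k \<le> n") auto
  then show "\<alpha> \<in> parts_in (insert k S) n"
    by cases (auto simp: parts_in_def)
qed

lemma finite_parts_in:
  assumes "finite S" "0 \<notin> S"
  shows "finite (parts_in S n)"
  using assms
proof (induction S arbitrary: n rule: finite_induct)
  case empty
  have "parts_in {} n \<subseteq> {{#}}" by (auto simp: parts_in_def)
  then show ?case by (rule finite_subset) simp
next
  case (insert k S)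
  show ?case
  proof (induction n rule: less_induct)
    case (less n)
    have "finite (parts_in S n)" using insert.IH insert.prems by simp
    moreover have "finite (parts_in (insert k S) (n - k))" if "k \<le> n"
      by (rule less) (use insert.prems that in auto)
    ultimately show ?case by (simp add: parts_in_insert[OF insert.hyps(2), of n])
  qed
qed

definition parts_fps :: "nat set \<Rightarrow> int fps" where
  "parts_fps S = Abs_fps (\<lambda>n. int (card (parts_in S n)))"

lemma parts_fps_insert:
  assumes "finite S" "0 \<notin> insert k S" "k \<notin> S"
  shows "(1 - fps_X ^ k) * parts_fps (insert k S) = parts_fps S"
proof (rule fps_ext)
  fix n
  have "card (parts_in (insert k S) n) = card (parts_in S n) +
      (if k \<le> n then card (parts_in (insert k S) (n - k)) else 0)"
  proof (cases "k \<le> n")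
    case True
    let ?T = "add_mset k ` parts_in (insert k S) (n - k)"
    have "parts_in (insert k S) n = parts_in S n \<union> ?T"
      using parts_in_insert[OF assms(3), of n] True by simp
    moreover have "finite (parts_in S n)" "finite ?T"
      using assms by (simp_all add: finite_parts_in)
    moreover have "k \<notin># \<alpha>" if "\<alpha> \<in> parts_in S n" for \<alpha>
      using that assms(3) unfolding parts_in_def by blast
    then have "parts_in S n \<inter> ?T = {}" by fastforce
    ultimately have "card (parts_in (insert k S) n) = card (parts_in S n) + card ?T"
      by (simp add: card_Un_disjoint)
    also have "card (add_mset k ` parts_in (insert k S) (n - k)) = card (parts_in (insert k S) (n - k))"
      by (rule card_image) (auto simp: inj_on_def)
    finally show ?thesis using True by simp
  next
    case False
    then show ?thesis using parts_in_insert[OF assms(3), of n] by simp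
  qed
  then show "fps_nth ((1 - fps_X ^ k) * parts_fps (insert k S)) n = fps_nth (parts_fps S) n"
    by (simp add: left_diff_distrib fps_X_power_mult_nth parts_fps_def)
qed

lemma parts_fps_prod:
  assumes "finite S" "0 \<notin> S"
  shows "(\<Prod>k\<in>S. 1 - fps_X ^ k) * parts_fps S = 1"
  using assms
proof (induction S rule: finite_induct)
  case empty
  have "parts_in {} n = (if n = 0 then {{#}} else {})" for n by (auto simp: parts_in_def)
  then show ?case by (intro fps_ext) (simp add: parts_fps_def)
next
  case (insert k S)
  have "(\<Prod>k\<in>insert k S. 1 - fps_X ^ k) * parts_fps (insert k S)
     = (\<Prod>k\<in>S. 1 - fps_X ^ k) * ((1 - fps_X ^ k) * parts_fps (insert k S))"
    using insert by (simp add: mult_ac)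
  also have "\<dots> = 1" using insert by (subst parts_fps_insert) auto
  finally show ?case .
qed

text \<open>No part of a partition of at most \<open>N\<close> exceeds \<open>N\<close>, so finite
  sets of allowed parts suffice; the pairs are then sorted by the size \<open>i\<close> of the first
  component.\<close>

lemma B_eq_nth:
  assumes "n \<le> N"
  shows "int (B u v n) = fps_nth (parts_fps {k\<in>{1..N}. \<not> u dvd k} * parts_fps {k\<in>{1..N}. \<not> v dvd k}) n"
proof -
  define P where "P w = parts_in {k\<in>{1..N}. \<not> w dvd k}" for w
  have fin: "finite (P w i)" for w i
    unfolding P_def by (rule finite_parts_in) auto
  have P_iff: "\<alpha> \<in> P w i \<longleftrightarrow> partition_of \<alpha> i \<and> regular w \<alpha>" if "i \<le> N" for w i \<alpha>
  proof -
    have "x \<le> N" if "x \<in># \<alpha>" "sum_mset \<alpha> = i" for x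
      using that \<open>i \<le> N\<close> sum_mset.remove[of x \<alpha>] by simp
    then show ?thesis
      unfolding P_def parts_in_def partition_of_def regular_def by (auto simp: Suc_le_eq)
  qed
  have "{(\<alpha>, \<beta>). (\<exists>i j. partition_of \<alpha> i \<and> partition_of \<beta> j \<and> i + j = n) \<and> regular u \<alpha> \<and> regular v \<beta>}
      = (\<Union>i\<in>{0..n}. P u i \<times> P v (n - i))"
  proof (intro equalityI subsetI; clarify)
    fix \<alpha> \<beta> i j
    assume "partition_of \<alpha> i" "partition_of \<beta> j" "n = i + j" "regular u \<alpha>" "regular v \<beta>"
    with assms show "(\<alpha>, \<beta>) \<in> (\<Union>k\<in>{0..i + j}. P u k \<times> P v (i + j - k))"
      by (auto simp: P_iff intro!: bexI[of _ i])
  next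
    fix \<alpha> \<beta> i
    assume "i \<in> {0..n}" "\<alpha> \<in> P u i" "\<beta> \<in> P v (n - i)"
    with assms show "(\<exists>i j. partition_of \<alpha> i \<and> partition_of \<beta> j \<and> i + j = n) \<and> regular u \<alpha> \<and> regular v \<beta>"
      by (intro conjI exI[of _ i] exI[of _ "n - i"]) (auto simp: P_iff)
  qed
  then have "B u v n = card (\<Union>i\<in>{0..n}. P u i \<times> P v (n - i))"
    unfolding B_def by simp
  also have "\<dots> = (\<Sum>i=0..n. card (P u i \<times> P v (n - i)))"
  proof (rule card_UN_disjoint)
    have "P u i \<inter> P u j = {}" if "i \<noteq> j" for i j
      using that by (auto simp: P_def parts_in_def)
    then show "\<forall>i\<in>{0..n}. \<forall>j\<in>{0..n}. i \<noteq> j \<longrightarrow> P u i \<times> P v (n - i) \<inter> P u j \<times> P v (n - j) = {}"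
      by (simp add: Times_Int_Times)
  qed (simp_all add: fin)
  finally show ?thesis
    by (simp add: fps_mult_nth parts_fps_def P_def card_cartesian_product)
qed

text \<open>The factors of \<open>euler u N\<close> with \<open>u * k > N\<close> are 1 up to order
  \<open>N\<close>; the others are the factors for the multiples of \<open>u\<close> up to
  \<open>N\<close>.\<close>

lemma eqm_prod_multiples:
  assumes "u > 0"
  shows "eqm N (\<Prod>k\<in>{k\<in>{1..N}. u dvd k}. 1 - fps_X ^ k) (euler u N)"
proof -
  have *: "{1..N} = {k\<in>{1..N}. u * k \<le> N} \<union> {k\<in>{1..N}. \<not> u * k \<le> N}" by auto
  have split: "euler u N = (\<Prod>k\<in>{k\<in>{1..N}. u * k \<le> N}. 1 - fps_X ^ (u * k)) *
      (\<Prod>k\<in>{k\<in>{1..N}. \<not> u * k \<le> N}. 1 - fps_X ^ (u * k))"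
    unfolding euler_def by (subst *, rule prod.union_disjoint) auto
  have "eqm N (euler u N) ((\<Prod>k\<in>{k\<in>{1..N}. u * k \<le> N}. 1 - fps_X ^ (u * k)) *
      (\<Prod>k\<in>{k\<in>{1..N}. \<not> u * k \<le> N}. 1))"
    unfolding split
    by (intro eqm_mult eqm_prod eqm_refl) (auto simp: eqm_def fps_X_power_nth)
  then have "eqm N (euler u N) (\<Prod>k\<in>{k\<in>{1..N}. u * k \<le> N}. 1 - fps_X ^ (u * k))"
    by simp
  moreover have "(\<Prod>k\<in>{k\<in>{1..N}. u * k \<le> N}. 1 - fps_X ^ (u * k)) = (\<Prod>k\<in>{k\<in>{1..N}. u dvd k}. 1 - fps_X ^ k :: int fps)"
  proof (rule prod.reindex_bij_witness[of _ "\<lambda>k. k div u" "\<lambda>k. u * k"])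
    fix k assume k: "k \<in> {k\<in>{1..N}. u dvd k}"
    then obtain j where j: "k = u * j" by auto
    have "j \<le> u * j" using assms by simp
    moreover have "u * j \<le> N" using k j by simp
    ultimately have "j \<le> N" by (rule order_trans)
    with k j assms show "u * (k div u) = k" "k div u \<in> {k\<in>{1..N}. u * k \<le> N}" by auto
  qed (use assms in auto)
  ultimately show ?thesis by (simp add: eqm_sym)
qed

lemma eqm_parts_regular:
  assumes "u > 0"
  shows "eqm N (euler 1 N * parts_fps {k\<in>{1..N}. \<not> u dvd k}) (euler u N)"
proof -
  have "euler 1 N = (\<Prod>k\<in>{k\<in>{1..N}. u dvd k} \<union> {k\<in>{1..N}. \<not> u dvd k}. 1 - fps_X ^ k)"
    unfolding euler_def by (rule prod.cong) auto
  also have "\<dots> = (\<Prod>k\<in>{k\<in>{1..N}. u dvd k}. 1 - fps_X ^ k) * (\<Prod>k\<in>{k\<in>{1..N}. \<not> u dvd k}. 1 - fps_X ^ k)"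
    by (rule prod.union_disjoint) auto
  finally have "euler 1 N * parts_fps {k\<in>{1..N}. \<not> u dvd k} = (\<Prod>k\<in>{k\<in>{1..N}. u dvd k}. 1 - fps_X ^ k)"
    using parts_fps_prod[of "{k\<in>{1..N}. \<not> u dvd k}"] by (simp add: mult.assoc)
  then show ?thesis using eqm_prod_multiples[OF assms] by simp
qed

lemma eqm_euler_cube: "eqm N (euler 3 N) (euler 1 N ^ 3)"
proof -
  have "eqm N (1 - fps_X ^ (3 * k)) ((1 - fps_X ^ (1 * k)) ^ 3)" for k
  proof -
    have "(1 - fps_X ^ (1 * k)) ^ 3 = (1 - fps_X ^ (3 * k) :: int fps)
       + fps_const 3 * (fps_X ^ (2 * k) - fps_X ^ k)"
      by (simp add: power3_eq_cube algebra_simps power_mult power2_eq_square numeral_fps_const[symmetric])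
    then show ?thesis by (simp add: eqm_def cong_iff_dvd_diff)
  qed
  then show ?thesis unfolding euler_def prod_power_distrib by (intro eqm_prod)
qed

lemma B3_eqm:
  assumes "v > 0" "n \<le> N"
  shows "[int (B 3 v n) = fps_nth (euler 1 N * euler v N) n] (mod 3)"
proof -
  let ?P = "\<lambda>u. parts_fps {k\<in>{1..N}. \<not> u dvd k}"
  \<comment> \<open>The series of all partitions with parts up to \<open>N\<close> inverts f_1 over
    the integers, so f_1^2 can be cancelled.\<close>
  let ?w = "parts_fps {1..N}"
  have w: "?w * euler 1 N = 1"
    using parts_fps_prod[of "{1..N}"] by (simp add: euler_def mult.commute)
  have "eqm N ((euler 1 N * ?P 3) * (euler 1 N * ?P v)) (euler 1 N ^ 3 * euler v N)"
    using assms by (intro eqm_mult eqm_trans[OF eqm_parts_regular eqm_euler_cube] eqm_parts_regular) auto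
  then have "eqm N (euler 1 N ^ 2 * (?P 3 * ?P v)) (euler 1 N ^ 2 * (euler 1 N * euler v N))"
    by (simp add: power2_eq_square power3_eq_cube mult_ac)
  moreover have "?w ^ 2 * euler 1 N ^ 2 = 1"
    using w by (simp flip: power_mult_distrib)
  ultimately have "eqm N (?P 3 * ?P v) (euler 1 N * euler v N)"
    by (rule eqm_cancel)
  then show ?thesis
    using assms by (simp add: B_eq_nth eqm_def)
qed

lemma B3_pentagonal:
  assumes "v > 0"
  shows "[int (B 3 v n) = (\<Sum>(m,l)\<in>{(m,l). pent m + v * pent l = n}. (-1) ^ nat \<bar>m\<bar> * (-1) ^ nat \<bar>l\<bar>)] (mod 3)"
proof -
  let ?I = "{-int n..int n}"
  have prod_eq: "(\<Sum>m\<in>?I. (-1) ^ nat \<bar>m\<bar> * fps_X ^ (1 * pent m)) * (\<Sum>l\<in>?I. (-1) ^ nat \<bar>l\<bar> * fps_X ^ (v * pent l))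
     = (\<Sum>(m,l)\<in>?I \<times> ?I. fps_const ((-1) ^ nat \<bar>m\<bar> * (-1) ^ nat \<bar>l\<bar>) * fps_X ^ (pent m + v * pent l) :: int fps)"
  proof -
    have c: "(-1) ^ j = fps_const ((-1 :: int) ^ j)" for j
      by (simp flip: fps_const_power fps_const_neg)
    show ?thesis
      unfolding c sum_product sum.cartesian_product
      by (intro sum.cong) (auto simp: power_add mult_ac simp flip: fps_const_mult)
  qed
  have "[int (B 3 v n) = fps_nth (euler 1 n * euler v n) n] (mod 3)"
    using assms by (rule B3_eqm) simp
  also have "[fps_nth (euler 1 n * euler v n) n = fps_nth ((\<Sum>m\<in>?I. (-1) ^ nat \<bar>m\<bar> * fps_X ^ (1 * pent m)) *
     (\<Sum>l\<in>?I. (-1) ^ nat \<bar>l\<bar> * fps_X ^ (v * pent l))) n] (mod 3)"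
    using eqm_mult[OF eqm_pentagonal eqm_pentagonal, of 1 v n] assms by (simp add: eqm_def)
  also have "fps_nth ((\<Sum>m\<in>?I. (-1) ^ nat \<bar>m\<bar> * fps_X ^ (1 * pent m)) *
     (\<Sum>l\<in>?I. (-1) ^ nat \<bar>l\<bar> * fps_X ^ (v * pent l))) n =
     (\<Sum>(m,l)\<in>?I \<times> ?I. if pent m + v * pent l = n then (-1) ^ nat \<bar>m\<bar> * (-1) ^ nat \<bar>l\<bar> else 0 :: int)"
    unfolding prod_eq fps_sum_nth by (rule sum.cong) (auto simp: fps_X_power_nth)
  also have "\<dots> = (\<Sum>(m,l)\<in>{(m,l). pent m + v * pent l = n}. (-1) ^ nat \<bar>m\<bar> * (-1) ^ nat \<bar>l\<bar>)"
  proof -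
    \<comment> \<open>A pentagonal number bounds its index, so the truncated double sum misses no
      solution.\<close>
    have bd: "\<bar>m\<bar> \<le> int (pent m)" for m
    proof (cases "m \<ge> 0")
      case True
      have "m * 0 \<le> m * (3 * m - 1)" using True by (cases "m = 0") (auto intro: mult_nonneg_nonneg)
      with pent_double[of m] True show ?thesis by (simp add: algebra_simps)
    next
      case False
      then have "0 \<le> m * (3 * m + 3)" by (intro mult_nonpos_nonpos) auto
      with pent_double[of m] False show ?thesis by (simp add: algebra_simps)
    qed
    have "m \<in> ?I" "l \<in> ?I" if "pent m + v * pent l = n" for m l
    proof -
      have "pent l \<le> v * pent l" using assms by simp
      with that have "pent m \<le> n" "pent l \<le> n" by linarith+
      with bd[of m] bd[of l] show "m \<in> ?I" "l \<in> ?I" by auto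
    qed
    then have sub: "{(m,l). pent m + v * pent l = n} \<subseteq> ?I \<times> ?I" by blast
    show ?thesis
      by (rule sum.mono_neutral_cong_right[OF _ sub]) (auto split: if_splits)
  qed
  finally show ?thesis .
qed

subsection \<open>Sums of a character over norm forms\<close>

definition chi3 :: "int \<Rightarrow> int" where
  "chi3 x = (if x mod 3 = 0 then 0 else if x mod 3 = 1 then 1 else -1)"

definition chi4 :: "int \<Rightarrow> int" where
  "chi4 x = (if even x then 0 else if x mod 4 = 1 then 1 else -1)"

definition chi12 :: "int \<Rightarrow> int" where
  "chi12 x = chi3 x * chi4 x"

lemma chi3_cong: "x mod 3 = y mod 3 \<Longrightarrow> chi3 x = chi3 y"
  by (simp add: chi3_def)

lemma chi4_cong: "x mod 4 = y mod 4 \<Longrightarrow> chi4 x = chi4 y"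
proof -
  assume "x mod 4 = y mod 4"
  moreover from this have "even x = even y" by presburger
  ultimately show ?thesis by (simp add: chi4_def)
qed

lemma chi3_mult: "chi3 (x * y) = chi3 x * chi3 y"
proof -
  have red: "chi3 (z mod 3) = chi3 z" for z
    by (rule chi3_cong) simp
  have "chi3 (x * y) = chi3 ((x mod 3) * (y mod 3))"
    by (rule chi3_cong) (simp add: mod_mult_eq)
  also have "x mod 3 \<in> {0,1,2}" "y mod 3 \<in> {0,1,2}" by auto
  then have "chi3 ((x mod 3) * (y mod 3)) = chi3 (x mod 3) * chi3 (y mod 3)"
    unfolding insert_iff empty_iff by (elim disjE; simp add: chi3_def)
  finally show ?thesis by (simp only: red)
qed

lemma chi4_mult: "chi4 (x * y) = chi4 x * chi4 y"
proof -
  have red: "chi4 (z mod 4) = chi4 z" for z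
    by (rule chi4_cong) simp
  have "chi4 (x * y) = chi4 ((x mod 4) * (y mod 4))"
    by (rule chi4_cong) (simp add: mod_mult_eq)
  also have "x mod 4 \<in> {0,1,2,3}" "y mod 4 \<in> {0,1,2,3}" by auto
  then have "chi4 ((x mod 4) * (y mod 4)) = chi4 (x mod 4) * chi4 (y mod 4)"
    unfolding insert_iff empty_iff by (elim disjE; simp add: chi4_def)
  finally show ?thesis by (simp only: red)
qed

lemma chi12_mult: "chi12 (x * y) = chi12 x * chi12 y"
  by (simp add: chi12_def chi3_mult chi4_mult)

lemma chi3_minus: "chi3 (- x) = - chi3 x"
  using chi3_mult[of "-1" x] by (simp add: chi3_def)

lemma chi4_minus: "chi4 (- x) = - chi4 x"
  using chi4_mult[of "-1" x] by (simp add: chi4_def)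

lemma chi12_minus [simp]: "chi12 (- x) = chi12 x"
  by (simp add: chi12_def chi3_minus chi4_minus)

text \<open>Both factors of \<open>chi12\<close> are odd, so negating the argument modulo exactly
  one of 3 and 4 reverses the sign. All cancellations below rest on this rule or its mirror
  image.\<close>

lemma chi12_neg_left: "3 dvd x + y \<Longrightarrow> 4 dvd x - y \<Longrightarrow> chi12 x = - chi12 y"
proof -
  assume "3 dvd x + y" "4 dvd x - y"
  then have "x mod 3 = (- y) mod 3" "x mod 4 = y mod 4" by (simp_all add: mod_eq_dvd_iff)
  then show ?thesis
    by (simp add: chi12_def chi3_cong[of x "- y"] chi4_cong[of x y] chi3_minus)
qed

lemma chi12_neg_right: "3 dvd x - y \<Longrightarrow> 4 dvd x + y \<Longrightarrow> chi12 x = - chi12 y"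
proof -
  assume "3 dvd x - y" "4 dvd x + y"
  then have "x mod 3 = y mod 3" "x mod 4 = (- y) mod 4" by (simp_all add: mod_eq_dvd_iff)
  then show ?thesis
    by (simp add: chi12_def chi3_cong[of x y] chi4_cong[of x "- y"] chi4_minus)
qed

lemma chi3_square: "chi3 x * chi3 x = (if 3 dvd x then 0 else 1)"
  by (simp add: chi3_def dvd_eq_mod_eq_0)

lemma chi4_square: "chi4 x * chi4 x = (if even x then 0 else 1)"
  by (simp add: chi4_def)

lemma chi12_square: "chi12 x * chi12 x = (if odd x \<and> \<not> 3 dvd x then 1 else 0)"
proof -
  have "chi12 x * chi12 x = (chi3 x * chi3 x) * (chi4 x * chi4 x)"
    by (simp only: chi12_def mult_ac)
  then show ?thesis by (simp only: chi3_square chi4_square) simp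
qed

lemma chi12_nonzero_iff: "chi12 x \<noteq> 0 \<longleftrightarrow> odd x \<and> \<not> 3 dvd x"
  using chi12_square[of x] by (auto split: if_splits)

section \<open>Representations by the norm form x^2 + v y^2\<close>

definition reps :: "int \<Rightarrow> int \<Rightarrow> (int \<times> int) set" where
  "reps v n = {(x, y). x\<^sup>2 + v * y\<^sup>2 = n}"

text \<open>Up to the factor 4, the coefficient of q^n in the eta product eta(24 z) eta(24 v
  z).\<close>

definition theta :: "int \<Rightarrow> int \<Rightarrow> int" where
  "theta v n = (\<Sum>(x, y)\<in>reps v n. chi12 (x * y))"

lemma finite_reps:
  assumes "v > 0"
  shows "finite (reps v n)"
proof -
  have b: "\<bar>z\<bar> \<le> z\<^sup>2" for z :: int
  proof (cases "z = 0")
    case False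
    then have "\<bar>z\<bar> * 1 \<le> \<bar>z\<bar> * \<bar>z\<bar>" by (intro mult_left_mono) auto
    then show ?thesis by (simp add: power2_eq_square)
  qed simp
  have "x \<in> {-n..n} \<and> y \<in> {-n..n}" if "x\<^sup>2 + v * y\<^sup>2 = n" for x y
  proof -
    have "1 * y\<^sup>2 \<le> v * y\<^sup>2" using assms by (intro mult_right_mono) auto
    then have "x\<^sup>2 \<le> n" "y\<^sup>2 \<le> n" using that zero_le_power2[of x] zero_le_power2[of y] by linarith+
    then show ?thesis using b[of x] b[of y] by auto
  qed
  then have "reps v n \<subseteq> {-n..n} \<times> {-n..n}" unfolding reps_def by blast
  then show ?thesis by (rule finite_subset) simp
qed

lemma sum_reps_scaled:
  assumes "p \<noteq> 0"
  shows "(\<Sum>(x, y)\<in>{(x, y) \<in> reps v (p\<^sup>2 * n). p dvd x \<and> p dvd y}. chi12 (x * y)) = chi12 (p * p) * theta v n"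
proof -
  have "(\<Sum>(x, y)\<in>{(x, y) \<in> reps v (p\<^sup>2 * n). p dvd x \<and> p dvd y}. chi12 (x * y))
      = (\<Sum>(x, y)\<in>reps v n. chi12 (p * x * (p * y)))"
  proof (rule sum.reindex_bij_witness[of _ "\<lambda>(x, y). (p * x, p * y)" "\<lambda>(x, y). (x div p, y div p)"])
    have eq: "(p * x)\<^sup>2 + v * (p * y)\<^sup>2 = p\<^sup>2 * (x\<^sup>2 + v * y\<^sup>2)" for x y
      by (simp add: algebra_simps power_mult_distrib)
    show "(case z of (x, y) \<Rightarrow> (x div p, y div p)) \<in> reps v n"
      if "z \<in> {(x, y) \<in> reps v (p\<^sup>2 * n). p dvd x \<and> p dvd y}" for z
      using that assms by (auto simp: reps_def eq elim!: dvdE)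
    show "(case z of (x, y) \<Rightarrow> (p * x, p * y)) \<in> {(x, y) \<in> reps v (p\<^sup>2 * n). p dvd x \<and> p dvd y}"
      if "z \<in> reps v n" for z
      using that by (auto simp: reps_def eq)
  qed (use assms in auto)
  also have "\<dots> = chi12 (p * p) * theta v n"
    unfolding theta_def sum_distrib_left by (rule sum.cong) (auto simp: chi12_mult)
  finally show ?thesis .
qed

lemma theta_inert:
  fixes p v n :: int
  assumes "prime p" "\<not> (\<exists>s. p dvd s\<^sup>2 + v)"
  shows "theta v (p\<^sup>2 * n) = chi12 (p * p) * theta v n"
proof -
  have "p dvd x \<and> p dvd y" if "x\<^sup>2 + v * y\<^sup>2 = p\<^sup>2 * n" for x y
  proof -
    have d: "p dvd x\<^sup>2 + v * y\<^sup>2" using that by simp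
    have y: "p dvd y"
    proof (rule ccontr)
      assume "\<not> p dvd y"
      then have "coprime y p" using assms(1) by (simp add: prime_imp_coprime coprime_commute)
      \<comment> \<open>For an inverse \<open>z\<close> of \<open>y\<close> modulo \<open>p\<close>,
        \<open>x * z\<close> would be a square root of -v.\<close>
      then obtain z where "[y * z = 1] (mod p)" using cong_solve_coprime_int by blast
      then have "p dvd y * z - 1" by (simp add: cong_iff_dvd_diff)
      then have "p dvd z\<^sup>2 * (x\<^sup>2 + v * y\<^sup>2) - v * (y * z + 1) * (y * z - 1)"
        using d by (blast intro: dvd_diff dvd_mult)
      also have "z\<^sup>2 * (x\<^sup>2 + v * y\<^sup>2) - v * (y * z + 1) * (y * z - 1) = (x * z)\<^sup>2 + v"
        by (simp add: power2_eq_square algebra_simps)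
      finally show False using assms(2) by blast
    qed
    then have "p dvd x\<^sup>2" using d by (simp add: dvd_add_left_iff power2_eq_square)
    with y assms(1) show ?thesis by (simp add: prime_dvd_power_iff)
  qed
  then have "reps v (p\<^sup>2 * n) = {(x, y) \<in> reps v (p\<^sup>2 * n). p dvd x \<and> p dvd y}"
    by (auto simp: reps_def)
  then show ?thesis
    using sum_reps_scaled[of p v n] assms(1) by (auto simp: theta_def)
qed

text \<open>Division by a + b sqrt(-v), of norm e p. Multiplying x + y sqrt(-v) by the conjugate
  gives the components \<open>x * a + v * y * b\<close> and \<open>y * a - x * b\<close>; the
  hypothesis \<open>dvd\<close> makes both divisible by e p, and the quotient has norm p^2 n / (e p)
  = m.\<close>

lemma sum_reps_multiples:
  fixes p v a b e n m :: int and f :: "int \<times> int \<Rightarrow> int"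
  assumes "e * p \<noteq> 0" and norm: "a\<^sup>2 + v * b\<^sup>2 = e * p" and em: "e * m = p * n"
    and dvd: "\<And>x y. (x, y) \<in> reps v (p\<^sup>2 * n) \<Longrightarrow> p dvd y * a - x * b \<Longrightarrow>
      e * p dvd x * a + v * y * b \<and> e * p dvd y * a - x * b"
  shows "(\<Sum>z\<in>{(x, y) \<in> reps v (p\<^sup>2 * n). p dvd y * a - x * b}. f z) =
    (\<Sum>(c, d)\<in>reps v m. f (a * c - v * b * d, a * d + b * c))"
proof (rule sum.reindex_bij_witness[of _ "\<lambda>(c, d). (a * c - v * b * d, a * d + b * c)"
      "\<lambda>(x, y). ((x * a + v * y * b) div (e * p), (y * a - x * b) div (e * p))"])
  have comp: "(x * a + v * y * b)\<^sup>2 + v * (y * a - x * b)\<^sup>2 = (a\<^sup>2 + v * b\<^sup>2) * (x\<^sup>2 + v * y\<^sup>2)" for x y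
    by (simp add: power2_eq_square algebra_simps)
  have comp': "(a * c - v * b * d)\<^sup>2 + v * (a * d + b * c)\<^sup>2 = (a\<^sup>2 + v * b\<^sup>2) * (c\<^sup>2 + v * d\<^sup>2)" for c d
    by (simp add: power2_eq_square algebra_simps)
  have backward: "a * (x * a + v * y * b) - v * b * (y * a - x * b) = (a\<^sup>2 + v * b\<^sup>2) * x"
      "a * (y * a - x * b) + b * (x * a + v * y * b) = (a\<^sup>2 + v * b\<^sup>2) * y" for x y
    by (simp_all add: power2_eq_square algebra_simps)
  have forward: "(a * c - v * b * d) * a + v * (a * d + b * c) * b = (a\<^sup>2 + v * b\<^sup>2) * c"
      "(a * d + b * c) * a - (a * c - v * b * d) * b = (a\<^sup>2 + v * b\<^sup>2) * d" for c d
    by (simp_all add: power2_eq_square algebra_simps)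
  have epm: "e * p * m = p\<^sup>2 * n" using em by (simp add: power2_eq_square algebra_simps)
  {
    fix z assume z: "z \<in> {(x, y) \<in> reps v (p\<^sup>2 * n). p dvd y * a - x * b}"
    obtain x y where xy: "z = (x, y)" by fastforce
    with z dvd[of x y] obtain c d where c: "x * a + v * y * b = e * p * c" and d: "y * a - x * b = e * p * d"
      by (auto elim!: dvdE)
    have "e * p * (a * c - v * b * d) = e * p * x"
      using backward(1)[of x y] unfolding c d norm by (simp add: algebra_simps)
    moreover have "e * p * (a * d + b * c) = e * p * y"
      using backward(2)[of y x] unfolding c d norm by (simp add: algebra_simps)
    ultimately have r: "a * c - v * b * d = x" "a * d + b * c = y" using assms(1) by simp_all
    have "(e * p) * (c\<^sup>2 + v * d\<^sup>2) = p\<^sup>2 * n"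
      using comp'[of c d] z unfolding r norm xy by (simp add: reps_def)
    then have "c\<^sup>2 + v * d\<^sup>2 = m" using assms(1) by (simp flip: epm)
    then show "(case case z of (x, y) \<Rightarrow> ((x * a + v * y * b) div (e * p), (y * a - x * b) div (e * p)) of
          (c, d) \<Rightarrow> (a * c - v * b * d, a * d + b * c)) = z"
        "(case z of (x, y) \<Rightarrow> ((x * a + v * y * b) div (e * p), (y * a - x * b) div (e * p))) \<in> reps v m"
      using assms(1) r by (simp_all add: xy c d reps_def)
    then show "(case case z of (x, y) \<Rightarrow> ((x * a + v * y * b) div (e * p), (y * a - x * b) div (e * p)) of
          (c, d) \<Rightarrow> f (a * c - v * b * d, a * d + b * c)) = f z"
      by (simp add: xy)
  }
  fix z assume z: "z \<in> reps v m"
  obtain c d where cd: "z = (c, d)" by fastforce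
  show "(case case z of (c, d) \<Rightarrow> (a * c - v * b * d, a * d + b * c) of
        (x, y) \<Rightarrow> ((x * a + v * y * b) div (e * p), (y * a - x * b) div (e * p))) = z"
    using assms(1) by (simp add: cd forward norm)
  show "(case z of (c, d) \<Rightarrow> (a * c - v * b * d, a * d + b * c))
      \<in> {(x, y) \<in> reps v (p\<^sup>2 * n). p dvd y * a - x * b}"
    using z by (simp add: cd forward norm reps_def comp' epm)
qed

text \<open>Inclusion-exclusion for the two families, whose sums add up to zero by
  \<open>cancel\<close>. For \<open>e\<close> above 1 the ideal of a + b sqrt(-v) has an extra
  factor of norm \<open>e\<close>; the hypothesis \<open>dvd\<close> says that it costs nothing,
  since the product with the conjugate is always divisible by \<open>e\<close>.\<close>

lemma theta_split:
  fixes p v a b e n m :: int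
  assumes p: "prime p" "odd p" and v: "v > 0" and pv: "\<not> p dvd v"
    and norm: "a\<^sup>2 + v * b\<^sup>2 = e * p" and em: "e * m = p * n" and e: "e > 0" "coprime e p"
    and dvd: "\<And>x y. x\<^sup>2 + v * y\<^sup>2 = p\<^sup>2 * n \<Longrightarrow> e dvd x * a + v * y * b \<and> e dvd y * a - x * b"
    and cancel: "\<And>c d. c\<^sup>2 + v * d\<^sup>2 = m \<Longrightarrow>
      chi12 ((a * c - v * b * d) * (a * d + b * c)) = - chi12 ((a * c + v * b * d) * (a * d - b * c))"
  shows "theta v (p\<^sup>2 * n) = - chi12 (p * p) * theta v n"
proof -
  let ?R = "reps v (p\<^sup>2 * n)"
  let ?f = "\<lambda>(x, y). chi12 (x * y)"
  let ?A = "\<lambda>b. {(x, y) \<in> ?R. p dvd y * a - x * b}"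
  have p0: "p > 0" using p(1) by (simp add: prime_gt_0_int)
  have fin: "finite ?R" using v by (rule finite_reps)
  have pe: "\<not> p dvd e" using e(2) p(1)
    by (metis coprime_common_divisor dvd_refl not_prime_unit)
  have pb: "\<not> p dvd b"
  proof
    assume pb: "p dvd b"
    then have "p dvd a\<^sup>2" using norm by (metis dvd_add_left_iff dvd_triv_right dvd_trans pos2 dvd_power)
    then have "p dvd a" using p(1) by (simp add: prime_dvd_power_iff)
    with pb have "p\<^sup>2 dvd a\<^sup>2 + v * b\<^sup>2" by (intro dvd_add dvd_mult) (simp_all add: dvd_power_same)
    then have "p * p dvd e * p" using norm by (simp add: power2_eq_square)
    then show False using pe p0 by simp
  qed
  have pa: "\<not> p dvd a"
  proof
    assume "p dvd a"
    then have "p dvd v * b\<^sup>2" using norm by (metis dvd_add_right_iff dvd_mult dvd_triv_right power2_eq_square)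
    then show False using pv pb p(1) by (simp add: prime_dvd_mult_iff prime_dvd_power_iff)
  qed
  have key: "e * p dvd x * a + v * y * b \<and> e * p dvd y * a - x * b"
    if R: "(x, y) \<in> ?R" and d: "p dvd y * a - x * b" for x y
  proof -
    \<comment> \<open>\<open>b\<close> is invertible modulo \<open>p\<close>, so divisibility by
      \<open>p\<close> passes from the second component to the first.\<close>
    have "b * (x * a + v * y * b) = y * (a\<^sup>2 + v * b\<^sup>2) - a * (y * a - x * b)"
      by (simp add: power2_eq_square algebra_simps)
    also have "p dvd \<dots>" using d by (simp add: norm)
    finally have "p dvd x * a + v * y * b" using pb p(1) by (simp add: prime_dvd_mult_iff)
    with d dvd[of x y] R e(2) show ?thesis by (simp add: reps_def divides_mult)
  qed
  have A: "sum ?f (?A b) = (\<Sum>(c, d)\<in>reps v m. chi12 ((a * c - v * b * d) * (a * d + b * c)))"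
    using sum_reps_multiples[OF _ norm em key, of ?f] p0 e(1) by simp
  have key': "e * p dvd x * a + v * y * (- b) \<and> e * p dvd y * a - x * (- b)"
    if "(x, y) \<in> ?R" "p dvd y * a - x * (- b)" for x y
  proof -
    \<comment> \<open>Conjugation up to sign: x to -x carries the family of \<open>- b\<close> to
      that of \<open>b\<close>.\<close>
    have "(- x, y) \<in> ?R" "p dvd y * a - (- x) * b" using that by (simp_all add: reps_def)
    from key[OF this] have "e * p dvd - (x * a + v * y * (- b)) \<and> e * p dvd y * a - x * (- b)"
      by (simp add: algebra_simps)
    then show ?thesis by (simp only: dvd_minus_iff)
  qed
  have norm': "a\<^sup>2 + v * (- b)\<^sup>2 = e * p" using norm by simp
  have A': "sum ?f (?A (- b)) = (\<Sum>(c, d)\<in>reps v m. chi12 ((a * c + v * b * d) * (a * d - b * c)))"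
    using sum_reps_multiples[OF _ norm' em key', of ?f] p0 e(1) by simp
  have AA': "sum ?f (?A b) + sum ?f (?A (- b)) = 0"
    unfolding A A' sum.distrib[symmetric]
    by (rule sum.neutral) (auto simp: reps_def cancel)
  have union: "?A b \<union> ?A (- b) = ?R"
  proof -
    have "p dvd y * a - x * b \<or> p dvd y * a - x * (- b)" if "(x, y) \<in> ?R" for x y
    proof -
      \<comment> \<open>The tests for the two families multiply to a combination of two norms, both
        divisible by \<open>p\<close>.\<close>
      have "(y * a - x * b) * (y * a - x * (- b)) = y\<^sup>2 * (a\<^sup>2 + v * b\<^sup>2) - b\<^sup>2 * (x\<^sup>2 + v * y\<^sup>2)"
        by (simp add: power2_eq_square algebra_simps)
      also have "x\<^sup>2 + v * y\<^sup>2 = p\<^sup>2 * n" using that by (simp add: reps_def)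
      also have "p dvd y\<^sup>2 * (a\<^sup>2 + v * b\<^sup>2) - b\<^sup>2 * (p\<^sup>2 * n)"
        unfolding norm by (rule dvd_diff) (simp_all add: power2_eq_square)
      finally show ?thesis using p(1) by (simp add: prime_dvd_mult_iff)
    qed
    then show ?thesis by auto
  qed
  have inter: "?A b \<inter> ?A (- b) = {(x, y) \<in> ?R. p dvd x \<and> p dvd y}"
  proof -
    have "p dvd x \<and> p dvd y" if "p dvd y * a - x * b" "p dvd y * a - x * (- b)" for x y
    proof -
      have "p dvd 2 * (y * a)" "p dvd 2 * (x * b)"
        using dvd_add[OF that] dvd_diff[OF that(2,1)] by (simp_all add: algebra_simps)
      moreover have "\<not> p dvd 2"
        using p prime_ge_2_int[OF p(1)] zdvd_imp_le[of p 2] by (cases "p = 2") auto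
      ultimately show ?thesis using pa pb p(1) by (simp add: prime_dvd_mult_iff)
    qed
    moreover have "p dvd y * a - x * b \<and> p dvd y * a - x * (- b)" if "p dvd x" "p dvd y" for x y
      using that by simp
    ultimately show ?thesis by blast
  qed
  have "sum ?f (?A b) + sum ?f (?A (- b)) = sum ?f ?R + sum ?f {(x, y) \<in> ?R. p dvd x \<and> p dvd y}"
  proof -
    have "finite (?A b)" "finite (?A (- b))" using fin by (auto intro: finite_subset[of _ ?R])
    from sum.union_inter[OF this, of ?f] show ?thesis by (simp only: union inter)
  qed
  then show ?thesis
    using AA' sum_reps_scaled[of p v n] p0 by (simp add: theta_def)
qed

subsection \<open>The split primes 2 and 3\<close>

text \<open>For solutions of nonzero weight exactly one of x = y and x = -y holds modulo
  \<open>r\<close>, which below is 3 for v = 2, 5 and 4 for v = 7. Which one holds tells which of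
  the two conjugate primes above 3 or 2 divides x + y sqrt(-v), halved when v = 7.\<close>

definition half_reps :: "int \<Rightarrow> int \<Rightarrow> int \<Rightarrow> (int \<times> int) set" where
  "half_reps r v n = {(x, y) \<in> reps v n. chi12 (x * y) \<noteq> 0 \<and> r dvd x - y}"

lemma theta_half_reps:
  assumes "v > 0" "r = 3 \<or> r = 4"
  shows "theta v n = 2 * (\<Sum>(x, y)\<in>half_reps r v n. chi12 (x * y))"
proof -
  let ?f = "\<lambda>(x, y). chi12 (x * y)"
  let ?g = "\<lambda>(x, y :: int). (x :: int, - y)"
  have fin: "finite (half_reps r v n)"
    by (rule finite_subset[OF _ finite_reps[OF assms(1), of n]]) (auto simp: half_reps_def)
  have inj: "inj_on ?g A" for A by (auto simp: inj_on_def)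
  have dich: "r dvd x - y \<longleftrightarrow> \<not> r dvd x + y" if "chi12 (x * y) \<noteq> 0" for x y
  proof -
    have "odd x" "odd y" "\<not> 3 dvd x" "\<not> 3 dvd y" using that by (auto simp: chi12_nonzero_iff)
    then show ?thesis using assms(2) by presburger
  qed
  have eq: "{(x, y) \<in> reps v n. chi12 (x * y) \<noteq> 0} = half_reps r v n \<union> ?g ` half_reps r v n"
  proof (intro equalityI subsetI; clarify)
    fix x y assume *: "(x, y) \<in> reps v n" "chi12 (x * y) \<noteq> 0" "(x, y) \<notin> ?g ` half_reps r v n"
    show "(x, y) \<in> half_reps r v n"
    proof (rule ccontr)
      assume "(x, y) \<notin> half_reps r v n"
      with * have "r dvd x + y" using dich by (auto simp: half_reps_def)
      with * have "(x, - y) \<in> half_reps r v n" by (auto simp: half_reps_def reps_def)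
      then have "?g (x, - y) \<in> ?g ` half_reps r v n" by (rule imageI)
      with *(3) show False by simp
    qed
  qed (auto simp: half_reps_def reps_def)
  have "theta v n = sum ?f {(x, y) \<in> reps v n. chi12 (x * y) \<noteq> 0}"
    unfolding theta_def by (rule sum.mono_neutral_right) (auto simp: finite_reps assms(1))
  also have "\<dots> = sum ?f (half_reps r v n) + sum ?f (?g ` half_reps r v n)"
    unfolding eq using fin by (rule sum.union_disjoint) (use fin dich in \<open>auto simp: half_reps_def\<close>)
  also have "sum ?f (?g ` half_reps r v n) = sum ?f (half_reps r v n)"
    by (subst sum.reindex[OF inj]) (auto simp: o_def intro!: sum.cong)
  finally show ?thesis by simp
qed

text \<open>In the coordinates x = y + r k, multiplication by a suitable element of norm
  \<open>c\<close> is an integral linear map \<open>(f, g)\<close>, even if the element is only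
  half-integral. It has to be a bijection between the halves for \<open>n\<close> and
  \<open>c * n\<close> that reverses \<open>chi12\<close>.\<close>

lemma theta_neg_by_substitution:
  fixes f g :: "int \<Rightarrow> int \<Rightarrow> int"
  assumes v: "v > 0" and r: "r = 3 \<or> r = 4" and c: "c \<noteq> 0"
    and norm: "\<And>y k. (f y k)\<^sup>2 + v * (g y k)\<^sup>2 = c * ((y + r * k)\<^sup>2 + v * y\<^sup>2)"
    and chi: "\<And>y k. chi12 (f y k * g y k) = - chi12 ((y + r * k) * y)"
    and cong: "\<And>y k. r dvd f y k - g y k"
    and inj: "\<And>y k y' k'. f y k = f y' k' \<Longrightarrow> g y k = g y' k' \<Longrightarrow> y = y' \<and> k = k'"
    and surj: "\<And>y k. (y + r * k)\<^sup>2 + v * y\<^sup>2 = c * n \<Longrightarrow> chi12 ((y + r * k) * y) \<noteq> 0 \<Longrightarrow>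
      \<exists>y' k'. f y' k' = y + r * k \<and> g y' k' = y"
  shows "theta v (c * n) = - theta v n"
proof -
  define S where "S = {(y, k). (y + r * k, y) \<in> half_reps r v n}"
  let ?h = "\<lambda>(x, y). chi12 (x * y)"
  let ?a = "\<lambda>(y, k). (y + r * k, y)" and ?b = "\<lambda>(y, k). (f y k, g y k)"
  have "?a ` S = half_reps r v n"
  proof (intro equalityI subsetI)
    fix z assume z: "z \<in> half_reps r v n"
    then obtain x y k where xy: "z = (x, y)" and "x - y = r * k"
      by (auto simp: half_reps_def dvd_def)
    then have "z = ?a (y, k)" by (simp add: algebra_simps)
    with z show "z \<in> ?a ` S" unfolding S_def by (intro image_eqI[of _ _ "(y, k)"]) auto
  qed (auto simp: S_def)
  moreover have "inj_on ?a S" using r by (auto simp: inj_on_def)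
  ultimately have A: "sum ?h (half_reps r v n) = sum (?h \<circ> ?a) S"
    using sum.reindex[of ?a S ?h] by simp
  have "?b ` S = half_reps r v (c * n)"
  proof (intro equalityI subsetI)
    fix z assume z: "z \<in> half_reps r v (c * n)"
    then obtain x y k where xy: "z = (x, y)" and "x - y = r * k"
      by (auto simp: half_reps_def dvd_def)
    then have x: "x = y + r * k" by simp
    obtain y' k' where "f y' k' = x" "g y' k' = y"
      using surj[of y k] z by (auto simp: xy x half_reps_def reps_def)
    then have b: "?b (y', k') = z" using xy by simp
    have "(y', k') \<in> S"
      using z norm[of y' k'] chi[of y' k'] c unfolding b[symmetric] S_def
      by (auto simp: half_reps_def reps_def)
    then show "z \<in> ?b ` S" using b by (intro image_eqI[of _ _ "(y', k')"]) auto
  qed (use norm chi cong in \<open>auto simp: S_def half_reps_def reps_def\<close>)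
  moreover have "inj_on ?b S" using inj by (auto simp: inj_on_def)
  ultimately have "sum ?h (half_reps r v (c * n)) = sum (?h \<circ> ?b) S"
    using sum.reindex[of ?b S ?h] by simp
  also have "\<dots> = - sum (?h \<circ> ?a) S"
    by (simp add: chi sum_negf[symmetric] case_prod_unfold o_def)
  finally show ?thesis
    unfolding theta_half_reps[OF v r] A by simp
qed

text \<open>Multiplication by the square of (1 + sqrt (-7)) / 2, a prime above 2.\<close>

lemma theta_7_prime_2:
  assumes "8 dvd n"
  shows "theta 7 (4 * n) = - theta 7 n"
proof (rule theta_neg_by_substitution[where r = 4 and f = "\<lambda>y k. - 5 * y - 6 * k" and g = "\<lambda>y k. 2 * k - y"])
  show "y = y' \<and> k = k'" if "- 5 * y - 6 * k = - 5 * y' - 6 * k'" "2 * k - y = 2 * k' - y'" for y k y' k' :: int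
    using that by (intro conjI; linarith)
  fix y k :: int
  show "chi12 ((- 5 * y - 6 * k) * (2 * k - y)) = - chi12 ((y + 4 * k) * y)"
  proof (rule chi12_neg_left)
    have "(- 5 * y - 6 * k) * (2 * k - y) + (y + 4 * k) * y = 3 * (2 * y * y - 4 * k * k)"
      "(- 5 * y - 6 * k) * (2 * k - y) - (y + 4 * k) * y = 4 * (y * y - 2 * k * y - 3 * k * k)"
      by (simp_all add: algebra_simps)
    then show "3 dvd (- 5 * y - 6 * k) * (2 * k - y) + (y + 4 * k) * y"
      "4 dvd (- 5 * y - 6 * k) * (2 * k - y) - (y + 4 * k) * y" by simp_all
  qed
  show "(- 5 * y - 6 * k)\<^sup>2 + 7 * (2 * k - y)\<^sup>2 = 4 * ((y + 4 * k)\<^sup>2 + 7 * y\<^sup>2)"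
    by (simp add: power2_eq_square algebra_simps)
  show "4 dvd (- 5 * y - 6 * k) - (2 * k - y)" by presburger
  assume *: "(y + 4 * k)\<^sup>2 + 7 * y\<^sup>2 = 4 * n" "chi12 ((y + 4 * k) * y) \<noteq> 0"
  from assms obtain j where j: "n = 8 * j" by (auto elim: dvdE)
  have y: "odd y" using * by (auto simp: chi12_nonzero_iff)
  \<comment> \<open>As 8 divides \<open>n\<close>, this vanishes modulo 4, which fixes first the
    parity of \<open>k\<close>, then that of (y + k) / 2.\<close>
  have n: "y * (y + k) + 2 * (k * k) = 4 * j"
    using * by (simp add: j power2_eq_square algebra_simps)
  have k: "odd k"
  proof
    assume "even k"
    then have "odd (y * (y + k) + 2 * (k * k))" using y by simp
    then show False unfolding n by simp
  qed
  obtain i where i: "y + k = 2 * i" using y k by (metis dvdE odd_even_add)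
  have "2 * (y * i + k * k) = 4 * j" using n unfolding i by (simp add: algebra_simps)
  then have "y * i = 2 * j - k * k" by simp
  then have "odd (y * i)" using k by simp
  then obtain l where "i = 2 * l + 1" by (auto elim: oddE)
  moreover obtain h where h: "y = 2 * h + 1" using y by (auto elim: oddE)
  ultimately have "k = 4 * l + 1 - 2 * h" using i by simp
  \<comment> \<open>The inverse map is y' = -(y + k) / 2, k' = (y - k) / 4, integral because y and
    (y + k) / 2 are odd.\<close>
  then show "\<exists>y' k'. - 5 * y' - 6 * k' = y + 4 * k \<and> 2 * k' - y' = y"
    using h by (intro exI[of _ "- 2 * l - 1"] exI[of _ "h - l"]) simp
qed simp_all

text \<open>With an even coordinate both sides vanish, so the congruence modulo 4 concerns odd pairs
  only. This matters for \<open>r = 3\<close>, where \<open>y\<close> and \<open>y + 3 * k\<close>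
  are both odd only if \<open>k\<close> is even.\<close>

lemma chi12_neg_substitution:
  assumes "even x = even x'" "even y = even y'"
    and "3 dvd x' * y' - x * y" and "odd x \<Longrightarrow> odd y \<Longrightarrow> 4 dvd x' * y' + x * y"
  shows "chi12 (x' * y') = - chi12 (x * y)"
proof (cases "odd x \<and> odd y")
  case True
  with assms(3,4) show ?thesis by (intro chi12_neg_right) simp_all
next
  case False
  then have "chi12 (x * y) = 0" "chi12 (x' * y') = 0"
    using assms(1,2) chi12_nonzero_iff[of "x * y"] chi12_nonzero_iff[of "x' * y'"] by auto
  then show ?thesis by simp
qed

text \<open>Multiplication by the square of 1 + sqrt (-2), a prime above 3.\<close>

lemma theta_2_prime_3:
  assumes "n mod 3 = 0"
  shows "theta 2 (9 * n) = - theta 2 n"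
proof (rule theta_neg_by_substitution[where r = 3 and f = "\<lambda>y k. - 5 * y - 3 * k" and g = "\<lambda>y k. y + 6 * k"])
  show "y = y' \<and> k = k'" if "- 5 * y - 3 * k = - 5 * y' - 3 * k'" "y + 6 * k = y' + 6 * k'" for y k y' k' :: int
    using that by (intro conjI; linarith)
  fix y k :: int
  show "chi12 ((- 5 * y - 3 * k) * (y + 6 * k)) = - chi12 ((y + 3 * k) * y)"
  proof (rule chi12_neg_substitution)
    have "(- 5 * y - 3 * k) * (y + 6 * k) - (y + 3 * k) * y = 3 * (- 2 * y * y - 12 * k * y - 6 * k * k)"
      by (simp add: algebra_simps)
    then show "3 dvd (- 5 * y - 3 * k) * (y + 6 * k) - (y + 3 * k) * y" by simp
    assume "odd (y + 3 * k)" "odd y"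
    then obtain l where l: "k = 2 * l" by auto
    have "(- 5 * y - 3 * k) * (y + 6 * k) + (y + 3 * k) * y = 4 * (- y * y - 15 * l * y - 18 * l * l)"
      by (simp add: algebra_simps l)
    then show "4 dvd (- 5 * y - 3 * k) * (y + 6 * k) + (y + 3 * k) * y" by simp
  qed auto
  show "(- 5 * y - 3 * k)\<^sup>2 + 2 * (y + 6 * k)\<^sup>2 = 9 * ((y + 3 * k)\<^sup>2 + 2 * y\<^sup>2)"
    by (simp add: power2_eq_square algebra_simps)
  show "3 dvd (- 5 * y - 3 * k) - (y + 6 * k)" by presburger
  assume *: "(y + 3 * k)\<^sup>2 + 2 * y\<^sup>2 = 9 * n" "chi12 ((y + 3 * k) * y) \<noteq> 0"
  from assms obtain j where j: "n = 3 * j" by auto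
  have y: "\<not> 3 dvd y" using * by (auto simp: chi12_nonzero_iff)
  \<comment> \<open>As 3 divides \<open>n\<close>, this vanishes modulo 9, which yields 9 dividing 2
    y + k one 3-adic digit at a time.\<close>
  have n: "y * (y + 2 * k) + 3 * (k * k) = 9 * j"
    using * by (simp add: j power2_eq_square algebra_simps)
  then have "3 dvd y * (y + 2 * k)" by presburger
  then have "3 dvd y + 2 * k" using y by (simp add: prime_dvd_mult_iff)
  then have "3 dvd k - y" by presburger
  then obtain l where "k - y = 3 * l" by (rule dvdE)
  then have l: "k = y + 3 * l" by simp
  have "3 * (2 * (y * (y + l)) + 6 * (l * y) + 9 * (l * l)) = 3 * (3 * j)"
    using n unfolding l by (simp add: algebra_simps)
  then have "3 dvd y * (y + l)" by presburger
  then have "3 dvd y + l" using y by (simp add: prime_dvd_mult_iff)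
  then obtain i where "y + l = 3 * i" by (rule dvdE)
  \<comment> \<open>The inverse map is k' = (2 y + k) / 9, y' = y - 6 k', and 2 y + k = 9 i.\<close>
  then show "\<exists>y' k'. - 5 * y' - 3 * k' = y + 3 * k \<and> y' + 6 * k' = y"
    using l by (intro exI[of _ "y - 6 * i"] exI[of _ i]) simp
qed simp_all

text \<open>Multiplication by half the square of 1 + sqrt (-5).\<close>

lemma theta_5_prime_3:
  assumes "n mod 3 = 0"
  shows "theta 5 (9 * n) = - theta 5 n"
proof (rule theta_neg_by_substitution[where r = 3 and f = "\<lambda>y k. - 7 * y - 6 * k" and g = "\<lambda>y k. 3 * k - y"])
  show "y = y' \<and> k = k'" if "- 7 * y - 6 * k = - 7 * y' - 6 * k'" "3 * k - y = 3 * k' - y'" for y k y' k' :: int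
    using that by (intro conjI; linarith)
  fix y k :: int
  \<comment> \<open>Modulo 2 this map exchanges the two coordinates, hence the change in the order
    of the factors.\<close>
  show "chi12 ((- 7 * y - 6 * k) * (3 * k - y)) = - chi12 ((y + 3 * k) * y)"
    unfolding mult.commute[of "y + 3 * k" y]
  proof (rule chi12_neg_substitution)
    have "(- 7 * y - 6 * k) * (3 * k - y) - y * (y + 3 * k) = 3 * (2 * y * y - 6 * k * y - 6 * k * k)"
      by (simp add: algebra_simps)
    then show "3 dvd (- 7 * y - 6 * k) * (3 * k - y) - y * (y + 3 * k)" by simp
    assume "odd (y + 3 * k)" "odd y"
    then obtain l where l: "k = 2 * l" by auto
    have "(- 7 * y - 6 * k) * (3 * k - y) + y * (y + 3 * k) = 4 * (2 * y * y - 6 * l * y - 18 * l * l)"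
      by (simp add: algebra_simps l)
    then show "4 dvd (- 7 * y - 6 * k) * (3 * k - y) + y * (y + 3 * k)" by simp
  qed auto
  show "(- 7 * y - 6 * k)\<^sup>2 + 5 * (3 * k - y)\<^sup>2 = 9 * ((y + 3 * k)\<^sup>2 + 5 * y\<^sup>2)"
    by (simp add: power2_eq_square algebra_simps)
  show "3 dvd (- 7 * y - 6 * k) - (3 * k - y)" by presburger
  assume *: "(y + 3 * k)\<^sup>2 + 5 * y\<^sup>2 = 9 * n" "chi12 ((y + 3 * k) * y) \<noteq> 0"
  from assms obtain j where j: "n = 3 * j" by auto
  have y: "\<not> 3 dvd y" using * by (auto simp: chi12_nonzero_iff)
  have n: "2 * (y * (y + k)) + 3 * (k * k) = 9 * j"
    using * by (simp add: j power2_eq_square algebra_simps)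
  then have "3 dvd y * (y + k)" by presburger
  then have "3 dvd y + k" using y by (simp add: prime_dvd_mult_iff)
  then obtain l where "y + k = 3 * l" by (rule dvdE)
  then have l: "k = 3 * l - y" by simp
  have "3 * (y * (y - l) - 3 * (l * y) + 9 * (l * l)) = 3 * (3 * j)"
    using n unfolding l by (simp add: algebra_simps)
  then have "3 dvd y * (y - l)" by presburger
  then have "3 dvd l - y" using y by (simp add: prime_dvd_mult_iff dvd_diff_commute)
  then obtain i where "l - y = 3 * i" by (rule dvdE)
  \<comment> \<open>The inverse map is k' = (2 y - k) / 9, y' = 3 k' - y, and 2 y - k = -9
    i.\<close>
  then show "\<exists>y' k'. - 7 * y' - 6 * k' = y + 3 * k \<and> 3 * k' - y' = y"
    using l by (intro exI[of _ "- y - 3 * i"] exI[of _ "- i"]) simp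
qed simp_all

subsection \<open>Primes represented by norm forms\<close>

text \<open>Pigeonhole: more than \<open>p\<close> pairs have entries up to floor(sqrt p), so two
  share the residue of x - s y, and their difference is small. The bounds are strict since a prime
  is no square.\<close>

lemma thue:
  fixes s :: int and p :: nat
  assumes "prime p"
  shows "\<exists>a b. (a, b) \<noteq> (0, 0) \<and> a\<^sup>2 < int p \<and> b\<^sup>2 < int p \<and> int p dvd a - s * b"
proof -
  define k where "k = floor_sqrt p"
  have k: "k\<^sup>2 < p" "p < (Suc k)\<^sup>2"
  proof -
    have "k\<^sup>2 \<noteq> p" using assms prime_power_iff[of k 2] by auto
    then show "k\<^sup>2 < p" using floor_sqrt_power2_le[of p] by (simp add: k_def le_neq_implies_less)
    show "p < (Suc k)\<^sup>2" unfolding k_def by (rule Suc_floor_sqrt_power2_gt)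
  qed
  let ?K = "{0..int k} \<times> {0..int k}"
  let ?f = "\<lambda>(x, y). (x - s * y) mod int p"
  have "?f ` ?K \<subseteq> {0..<int p}" using assms by (auto simp: prime_gt_0_nat)
  then have "card (?f ` ?K) \<le> p" using card_mono[of "{0..<int p}"] by fastforce
  also have "p < card ?K" using k(2) by (simp add: card_cartesian_product power2_eq_square nat_add_distrib)
  finally have "\<not> inj_on ?f ?K" by (rule pigeonhole)
  then obtain x y x' y' where xy: "x \<in> {0..int k}" "y \<in> {0..int k}" "x' \<in> {0..int k}" "y' \<in> {0..int k}"
    "(x, y) \<noteq> (x', y')" "(x - s * y) mod int p = (x' - s * y') mod int p"
    unfolding inj_on_def by auto
  have sq: "(u - w)\<^sup>2 < int p" if "u \<in> {0..int k}" "w \<in> {0..int k}" for u w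
  proof -
    have "\<bar>u - w\<bar> \<le> int k" using that by auto
    then have "\<bar>u - w\<bar>\<^sup>2 \<le> (int k)\<^sup>2" by (rule power_mono) simp
    also have "\<dots> < int p" using k(1) by (simp flip: of_nat_power)
    finally show ?thesis by simp
  qed
  have "int p dvd (x - s * y) - (x' - s * y')" using xy(6) by (simp add: mod_eq_dvd_iff)
  then have "int p dvd (x - x') - s * (y - y')" by (simp add: algebra_simps)
  then show ?thesis
    using xy(1-5) sq by (intro exI[of _ "x - x'"] exI[of _ "y - y'"]) auto
qed

text \<open>By Thue, a = s b modulo \<open>p\<close>, so a^2 + v b^2 is a multiple of
  \<open>p\<close>; the strict bounds keep it below (v + 1) p.\<close>

lemma small_multiple_represented:
  fixes s v :: int and p :: nat
  assumes "prime p" "int p dvd s\<^sup>2 + v" "v > 0"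
  shows "\<exists>a b j. a\<^sup>2 + v * b\<^sup>2 = j * int p \<and> 0 < j \<and> j \<le> v \<and> a\<^sup>2 < int p \<and> b\<^sup>2 < int p"
proof -
  obtain a b where ab: "(a, b) \<noteq> (0, 0)" "a\<^sup>2 < int p" "b\<^sup>2 < int p" "int p dvd a - s * b"
    using thue[OF assms(1)] by blast
  have "a\<^sup>2 + v * b\<^sup>2 = (a - s * b) * (a + s * b) + (s\<^sup>2 + v) * b\<^sup>2"
    by (simp add: power2_eq_square algebra_simps)
  also have "int p dvd \<dots>" by (rule dvd_add[OF dvd_mult2[OF ab(4)] dvd_mult2[OF assms(2)]])
  finally obtain j where "a\<^sup>2 + v * b\<^sup>2 = int p * j" by (rule dvdE)
  then have j: "a\<^sup>2 + v * b\<^sup>2 = j * int p" by (simp only: mult.commute)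
  have "v * b\<^sup>2 \<ge> 0" "b \<noteq> 0 \<Longrightarrow> v * b\<^sup>2 > 0" using assms(3) by simp_all
  then have "j * int p > 0"
    using ab(1) unfolding j[symmetric] by (cases "b = 0") (auto intro: add_nonneg_pos)
  then have "j > 0" by (simp add: zero_less_mult_iff)
  moreover have "v * b\<^sup>2 < v * int p" using ab(3) assms(3) by simp
  then have "j * int p < (v + 1) * int p" using ab(2) unfolding j[symmetric] by (simp add: algebra_simps)
  then have "j < v + 1" by (rule mult_right_less_imp_less) simp
  ultimately show ?thesis using j ab by (intro exI[of _ a] exI[of _ b] exI[of _ j]) simp
qed

section \<open>Squares and norms modulo small numbers, and small multiples of p\<close>

lemma square_mod_3: "(x :: int)\<^sup>2 mod 3 = (if 3 dvd x then 0 else 1)"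
proof -
  have "x\<^sup>2 mod 3 = (x mod 3)\<^sup>2 mod 3" by (simp add: power_mod)
  moreover have "x mod 3 = 0 \<or> x mod 3 = 1 \<or> x mod 3 = 2" by presburger
  moreover have "3 dvd x \<longleftrightarrow> 3 dvd x mod 3" by presburger
  ultimately show ?thesis by (elim disjE) simp_all
qed

lemma square_mod_8: "(x :: int)\<^sup>2 mod 8 = (if odd x then 1 else if 4 dvd x then 0 else 4)"
proof -
  have "x\<^sup>2 mod 8 = (x mod 8)\<^sup>2 mod 8" by (simp add: power_mod)
  moreover have "x mod 8 = 0 \<or> x mod 8 = 1 \<or> x mod 8 = 2 \<or> x mod 8 = 3 \<or> x mod 8 = 4
    \<or> x mod 8 = 5 \<or> x mod 8 = 6 \<or> x mod 8 = 7" by presburger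
  moreover have "odd x = odd (x mod 8)" "4 dvd x \<longleftrightarrow> 4 dvd x mod 8" by presburger+
  ultimately show ?thesis by (elim disjE) simp_all
qed

lemma norm_mod: "(a\<^sup>2 + v * b\<^sup>2) mod m = (a\<^sup>2 mod m + v * (b\<^sup>2 mod m)) mod (m :: int)"
  by (intro mod_add_cong) (simp_all add: mod_mult_right_eq)

lemma square_mod_8_cases:
  fixes x :: int
  obtains "odd x" "x\<^sup>2 mod 8 = 1" | "even x" "x\<^sup>2 mod 8 = 0" | "even x" "x\<^sup>2 mod 8 = 4"
  using square_mod_8[of x] by (cases "odd x"; cases "4 dvd x") auto

lemma norm_2_mod_8:
  fixes a b :: int
  assumes "odd (a\<^sup>2 + 2 * b\<^sup>2)"
  shows "odd a \<and> (a\<^sup>2 + 2 * b\<^sup>2) mod 8 = (if odd b then 3 else 1)"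
  unfolding norm_mod[of a 2 b]
  by (rule square_mod_8_cases[of a]; rule square_mod_8_cases[of b]) (use assms in simp_all)

lemma norm_5_mod_8:
  fixes a b :: int
  shows "odd a \<and> odd b \<and> (a\<^sup>2 + 5 * b\<^sup>2) mod 8 = 6 \<or>
    even a \<and> even b \<and> (a\<^sup>2 + 5 * b\<^sup>2) mod 8 \<in> {0, 4} \<or> (a\<^sup>2 + 5 * b\<^sup>2) mod 8 \<in> {1, 5}"
  unfolding norm_mod[of a 5 b]
  by (rule square_mod_8_cases[of a]; rule square_mod_8_cases[of b]) simp_all

lemma norm_7_mod_8:
  fixes a b :: int
  assumes "even (a\<^sup>2 + 7 * b\<^sup>2)"
  shows "odd a \<and> odd b \<and> (a\<^sup>2 + 7 * b\<^sup>2) mod 8 = 0 \<or>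
    even a \<and> even b \<and> (a\<^sup>2 + 7 * b\<^sup>2) mod 8 \<in> {0, 4}"
  unfolding norm_mod[of a 7 b]
  by (rule square_mod_8_cases[of a]; rule square_mod_8_cases[of b]) (use assms in simp_all)

text \<open>For the multiple 2 p the first variable is even, and dividing by 2 exchanges the two
  variables. The same descent handles 5 p and 7 p for the forms with v = 5 and v = 7.\<close>

lemma norm_form_2:
  fixes p :: nat and s :: int
  assumes "prime p" "odd p" "int p dvd s\<^sup>2 + 2"
  shows "\<exists>a b. a\<^sup>2 + 2 * b\<^sup>2 = int p"
proof -
  obtain a b j where ab: "a\<^sup>2 + 2 * b\<^sup>2 = j * int p" "0 < j" "j \<le> 2"
    using small_multiple_represented[OF assms(1,3)] by auto
  then consider "j = 1" | "j = 2" by linarith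
  then show ?thesis
  proof cases
    case 2
    have "a\<^sup>2 = 2 * (int p - b\<^sup>2)" using ab(1) 2 by simp
    then have "even (a\<^sup>2)" by simp
    then obtain c where "a = 2 * c" by auto
    then have "b\<^sup>2 + 2 * c\<^sup>2 = int p" using ab(1) 2 by (simp add: power_mult_distrib)
    then show ?thesis by blast
  qed (use ab in auto)
qed

text \<open>\<open>p\<close> lies in the class that the form does not represent. The multiples 4 p
  and 5 p descend to the impossible \<open>p\<close>, while 3 p leads to 2 p.\<close>

lemma norm_form_5:
  fixes p :: nat and s :: int
  assumes p: "prime p" "p mod 4 = 3" and "int p dvd s\<^sup>2 + 5"
  shows "\<exists>a b. a\<^sup>2 + 5 * b\<^sup>2 = 2 * int p"
proof -
  have p4: "int p mod 4 = 3" using p(2) by presburger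
  obtain a b j where ab: "a\<^sup>2 + 5 * b\<^sup>2 = j * int p" "0 < j" "j \<le> 5"
    using small_multiple_represented[OF p(1) assms(3)] by auto
  have not_p: "c\<^sup>2 + 5 * d\<^sup>2 \<noteq> int p" for c d
  proof
    assume "c\<^sup>2 + 5 * d\<^sup>2 = int p"
    moreover have "int p mod 8 = 3 \<or> int p mod 8 = 7" using p4 by presburger
    ultimately show False using norm_5_mod_8[of c d] by auto
  qed
  consider "j = 1" | "j = 2" | "j = 3" | "j = 4" | "j = 5" using ab(2,3) by linarith
  then show ?thesis
  proof cases
    case 1
    then show ?thesis using ab(1) not_p by simp
  next
    case 2
    then show ?thesis using ab(1) by auto
  next
    case 3
    have from_sum: "\<exists>u w. u\<^sup>2 + 5 * w\<^sup>2 = 2 * int p" if c: "3 dvd a + c" "a\<^sup>2 + 5 * c\<^sup>2 = 3 * int p" for c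
    proof -
      \<comment> \<open>Multiply a + c sqrt(-5) by 1 + sqrt(-5), of norm 6, and divide by 3: the
        norm 3 p becomes 2 p.\<close>
      obtain w where w: "a + c = 3 * w" using c(1) by (rule dvdE)
      then have a: "a = 3 * w - c" by simp
      have "9 * (w - 2 * c)\<^sup>2 + 5 * (9 * w\<^sup>2) = 6 * (a\<^sup>2 + 5 * c\<^sup>2)"
        unfolding a by (simp add: power2_eq_square algebra_simps)
      then have "(w - 2 * c)\<^sup>2 + 5 * w\<^sup>2 = 2 * int p" unfolding c(2) by simp
      then show ?thesis by blast
    qed
    have "a\<^sup>2 + 5 * b\<^sup>2 = 3 * int p" using ab(1) 3 by simp
    moreover from this have "3 dvd a + b \<or> 3 dvd a + (- b)"
    proof -
      have "(a + b) * (a - b) = 3 * (int p - 2 * b\<^sup>2)"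
        using ab(1) 3 by (simp add: power2_eq_square algebra_simps)
      then have "3 dvd (a + b) * (a - b)" by simp
      then show ?thesis by (simp add: prime_dvd_mult_iff)
    qed
    ultimately show ?thesis using from_sum[of b] from_sum[of "- b"] by auto
  next
    case 4
    have "4 * int p mod 8 = 4" using p4 by presburger
    then have "even a \<and> even b"
      using norm_5_mod_8[of a b] unfolding ab(1) 4 by simp
    then obtain c d where "a = 2 * c" "b = 2 * d" by (auto elim!: evenE)
    then have "c\<^sup>2 + 5 * d\<^sup>2 = int p" using ab(1) 4 by (simp add: power_mult_distrib)
    then show ?thesis using not_p by simp
  next
    case 5
    have "a\<^sup>2 = 5 * (int p - b\<^sup>2)" using ab(1) 5 by simp
    then have "5 dvd a\<^sup>2" by simp
    then obtain c where "a = 5 * c" by (auto simp: prime_dvd_power_iff elim: dvdE)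
    then have "b\<^sup>2 + 5 * c\<^sup>2 = int p" using ab(1) 5 by (simp add: power_mult_distrib)
    then show ?thesis using not_p by simp
  qed
qed

lemma square_mod_5_cases:
  fixes x :: int
  obtains "5 dvd x" "x\<^sup>2 mod 5 = 0" | "x\<^sup>2 mod 5 = 1" | "x\<^sup>2 mod 5 = 4"
proof -
  have "x\<^sup>2 mod 5 = (x mod 5)\<^sup>2 mod 5" by (simp add: power_mod)
  moreover have "5 dvd x \<and> x mod 5 = 0 \<or> x mod 5 = 1 \<or> x mod 5 = 2 \<or> x mod 5 = 3 \<or> x mod 5 = 4"
    by presburger
  ultimately show ?thesis using that by (elim disjE) simp_all
qed

text \<open>Even values of the form are divisible by 4, which excludes 2 p. As 3 and 5 are inert in
  Q(sqrt(-7)), 9 would divide 3 p or 6 p, against p = 2 modulo 3, and 25 would divide 5 p. The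
  multiples 4 p and 7 p descend to \<open>p\<close>.\<close>

lemma norm_form_7:
  fixes p :: nat and s :: int
  assumes p: "prime p" "odd p" "p mod 3 = 2" and "int p dvd s\<^sup>2 + 7"
  shows "\<exists>a b. a\<^sup>2 + 7 * b\<^sup>2 = int p"
proof -
  have p3: "int p mod 3 = 2" and p2: "odd (int p)" using p(2,3) by presburger+
  obtain a b j where ab: "a\<^sup>2 + 7 * b\<^sup>2 = j * int p" "0 < j" "j \<le> 7" "a\<^sup>2 < int p" "b\<^sup>2 < int p"
    using small_multiple_represented[OF p(1) assms(4)] by auto
  have dvd3: "\<exists>m. j * int p = 9 * m" if "3 dvd j"
  proof -
    have "3 dvd j * int p" using that by simp
    then have "3 dvd a \<and> 3 dvd b"
      unfolding ab(1)[symmetric] dvd_eq_mod_eq_0[of _ "_ + _"] norm_mod[of a 7 b 3] square_mod_3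
      by (cases "3 dvd a"; cases "3 dvd b") simp_all
    then obtain c d where "a = 3 * c" "b = 3 * d" by (auto elim!: dvdE)
    then have "j * int p = 9 * (c\<^sup>2 + 7 * d\<^sup>2)"
      by (simp add: ab(1)[symmetric] power_mult_distrib)
    then show ?thesis by blast
  qed
  consider "j = 1" | "j = 2" | "j = 3" | "j = 4" | "j = 5" | "j = 6" | "j = 7" using ab(2,3) by linarith
  then show ?thesis
  proof cases
    case 1
    then show ?thesis using ab(1) by auto
  next
    case 2
    have "2 * int p mod 8 = 2 \<or> 2 * int p mod 8 = 6" using p2 by presburger
    then have False using norm_7_mod_8[of a b] unfolding ab(1) 2 by auto
    then show ?thesis ..
  next
    case 3
    then have False using dvd3 p3 by presburger
    then show ?thesis ..
  next
    case 4
    have "4 * int p mod 8 = 4" using p2 by presburger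
    then have "even a \<and> even b"
      using norm_7_mod_8[of a b] unfolding ab(1) 4 by simp
    then obtain c d where "a = 2 * c" "b = 2 * d" by (auto elim!: evenE)
    then have "c\<^sup>2 + 7 * d\<^sup>2 = int p" using ab(1) 4 by (simp add: power_mult_distrib)
    then show ?thesis by blast
  next
    case 5
    have mod_5: "(a\<^sup>2 mod 5 + 7 * (b\<^sup>2 mod 5)) mod 5 = 0"
      unfolding norm_mod[symmetric] using ab(1) 5 by simp
    have "5 dvd a \<and> 5 dvd b"
      by (rule square_mod_5_cases[of a]; rule square_mod_5_cases[of b]) (use mod_5 in simp_all)
    then obtain c d where cd: "a = 5 * c" "b = 5 * d" by (auto elim!: dvdE)
    then have "5 * (c\<^sup>2 + 7 * d\<^sup>2) = int p" using ab(1) 5 by (simp add: power_mult_distrib)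
    then have "5 dvd p" by presburger
    then have "p = 5" using p(1) primes_dvd_imp_eq[of 5 p] by auto
    \<comment> \<open>\<open>p = 5\<close> passes the divisibility test; here the Thue bounds force
      both multiples of 5 to vanish.\<close>
    then have "25 * c\<^sup>2 < 5" "25 * d\<^sup>2 < 5"
      using ab(4,5) by (simp_all only: cd power_mult_distrib of_nat_numeral) simp_all
    then have "c\<^sup>2 \<le> 0" "d\<^sup>2 \<le> 0" by linarith+
    then have "c = 0" "d = 0" by simp_all
    then show ?thesis using ab(1,2) cd p(1) by auto
  next
    case 6
    then have False using dvd3 p3 by presburger
    then show ?thesis ..
  next
    case 7
    have "a\<^sup>2 = 7 * (int p - b\<^sup>2)" using ab(1) 7 by simp
    then have "7 dvd a\<^sup>2" by simp
    then obtain c where "a = 7 * c" by (auto simp: prime_dvd_power_iff elim: dvdE)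
    then have "b\<^sup>2 + 7 * c\<^sup>2 = int p" using ab(1) 7 by (simp add: power_mult_distrib)
    then show ?thesis by blast
  qed
qed

subsection \<open>The effect of multiplying the argument by the square of a prime\<close>

lemma Kronecker_minus:
  fixes v :: int
  assumes "p \<noteq> 2" "\<not> int p dvd v"
  shows "Kronecker (- v) p = (if \<exists>s. int p dvd s\<^sup>2 + v then 1 else -1)"
  using assms by (simp add: Kronecker_def Legendre_def QuadRes_def cong_iff_dvd_diff)

lemma prime_gt_3_facts:
  assumes "prime p" "p \<noteq> 2" "p \<noteq> 3"
  shows "prime (int p)" "odd (int p)" "chi12 (int p * int p) = 1"
proof -
  show "prime (int p)" using assms(1) by simp
  show o: "odd (int p)"
    using assms(1,2) primes_dvd_imp_eq[of 2 p] by auto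
  have "\<not> 3 dvd p" using assms(1,3) primes_dvd_imp_eq[of 3 p] by auto
  then have "\<not> 3 dvd int p" by presburger
  with o show "chi12 (int p * int p) = 1" by (simp add: chi12_mult chi12_square)
qed

lemma theta_Kronecker:
  fixes v n :: int
  assumes p: "prime p" "p \<noteq> 2" "p \<noteq> 3" "\<not> int p dvd v"
    and split: "\<exists>s. int p dvd s\<^sup>2 + v \<Longrightarrow> theta v ((int p)\<^sup>2 * n) = - chi12 (int p * int p) * theta v n"
  shows "theta v ((int p)\<^sup>2 * n) = - Kronecker (- v) p * theta v n"
  using theta_inert[of "int p" v n] split Kronecker_minus[of p v] prime_gt_3_facts[OF p(1-3)] p
  by auto

lemma theta_7:
  assumes p: "prime p" "p mod 3 = 2"
  shows "theta 7 ((int p)\<^sup>2 * (24 * m + 8)) = - Kronecker (- 7) p * theta 7 (24 * m + 8)"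
proof (cases "p = 2")
  case True
  have "(8 :: int) dvd 24 * m + 8" by presburger
  from theta_7_prime_2[OF this] True show ?thesis by (simp add: Kronecker_def)
next
  case False
  have "p \<noteq> 3" "p \<noteq> 7" using p(2) by auto
  then have "\<not> int p dvd int 7"
    using p(1) primes_dvd_imp_eq[of p 7] unfolding int_dvd_int_iff by auto
  then have p7: "\<not> int p dvd 7" by simp
  note pr = prime_gt_3_facts[OF p(1) False \<open>p \<noteq> 3\<close>]
  have p3: "int p mod 3 = 2" using p(2) by presburger
  show ?thesis
  proof (rule theta_Kronecker[OF p(1) False \<open>p \<noteq> 3\<close> p7])
    assume "\<exists>s. int p dvd s\<^sup>2 + 7"
    then obtain s where s: "int p dvd s\<^sup>2 + 7" ..
    have "odd p" using pr(2) by simp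
    from norm_form_7[OF p(1) this p(2) s] obtain a b where ab: "a\<^sup>2 + 7 * b\<^sup>2 = int p" by blast
    show "theta 7 ((int p)\<^sup>2 * (24 * m + 8)) = - chi12 (int p * int p) * theta 7 (24 * m + 8)"
    proof (rule theta_split[OF pr(1,2) _ p7, of a b 1 "int p * (24 * m + 8)"])
      fix c d :: int
      \<comment> \<open>The two products differ by 2ab(c^2 - 7 d^2) and add up to 2cd(a^2 - 7 b^2).
        An odd norm makes ab even; a norm that is 2 modulo 3 makes a and b prime to 3.\<close>
      have "even (a * b)" using pr(2) unfolding ab[symmetric] by auto
      then have "4 dvd 2 * (a * b) * (c\<^sup>2 - 7 * d\<^sup>2)"
        using mult_dvd_mono[of 2 2 2 "a * b"] by simp
      moreover have "3 dvd 2 * (c * d) * (a\<^sup>2 - 7 * b\<^sup>2)"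
      proof -
        have "(a\<^sup>2 mod 3 + 7 * (b\<^sup>2 mod 3)) mod 3 = 2"
          using p3 unfolding norm_mod[symmetric] ab .
        then have "a\<^sup>2 mod 3 = 1 \<and> b\<^sup>2 mod 3 = 1"
          unfolding square_mod_3 by (cases "3 dvd a"; cases "3 dvd b") simp_all
        then have "3 dvd a\<^sup>2 - 7 * b\<^sup>2" by presburger
        then show ?thesis by simp
      qed
      ultimately show "chi12 ((a * c - 7 * b * d) * (a * d + b * c)) = - chi12 ((a * c + 7 * b * d) * (a * d - b * c))"
        by (intro chi12_neg_left) (simp_all add: power2_eq_square algebra_simps)
    qed (use ab in auto)
  qed
qed

text \<open>Modulo 3 the form is a^2 - b^2, which vanishes when neither variable does.\<close>

lemma product_dvd_3_of_norm:
  fixes a b v :: int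
  assumes "v mod 3 = 2" "\<not> 3 dvd a\<^sup>2 + v * b\<^sup>2"
  shows "3 dvd a * b"
proof (rule ccontr)
  assume "\<not> 3 dvd a * b"
  then have "\<not> 3 dvd a" "\<not> 3 dvd b" by auto
  then have "(a\<^sup>2 + v * b\<^sup>2) mod 3 = (1 + v) mod 3"
    by (simp add: norm_mod[of a v b] square_mod_3)
  also have "\<dots> = 0" using assms(1) by presburger
  finally show False using assms(2) by (simp add: dvd_eq_mod_eq_0)
qed

lemma theta_5:
  assumes p: "prime p" "p mod 4 = 3"
  shows "theta 5 ((int p)\<^sup>2 * (24 * m + 6)) = - Kronecker (- 5) p * theta 5 (24 * m + 6)"
proof (cases "p = 3")
  case True
  have "(24 * m + 6) mod 3 = 0" by presburger
  from theta_5_prime_3[OF this]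
  have "theta 5 ((int p)\<^sup>2 * (24 * m + 6)) = - theta 5 (24 * m + 6)" using True by simp
  moreover have "\<exists>s. int p dvd s\<^sup>2 + 5" using True by (intro exI[of _ 1]) simp
  then have "Kronecker (- 5) p = 1" using True by (simp add: Kronecker_minus)
  ultimately show ?thesis by simp
next
  case False
  have "p \<noteq> 2" "p \<noteq> 5" using p(2) by auto
  then have "\<not> int p dvd int 5"
    using p(1) primes_dvd_imp_eq[of p 5] unfolding int_dvd_int_iff by auto
  then have p5: "\<not> int p dvd 5" by simp
  note pr = prime_gt_3_facts[OF p(1) \<open>p \<noteq> 2\<close> False]
  have p4: "int p mod 4 = 3" using p(2) by presburger
  have not3: "\<not> 3 dvd p" using primes_dvd_imp_eq[of 3 p] p(1) False by auto
  show ?thesis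
  proof (rule theta_Kronecker[OF p(1) \<open>p \<noteq> 2\<close> False p5])
    assume "\<exists>s. int p dvd s\<^sup>2 + 5"
    then obtain s where s: "int p dvd s\<^sup>2 + 5" ..
    from norm_form_5[OF p s] obtain a b where ab: "a\<^sup>2 + 5 * b\<^sup>2 = 2 * int p" by blast
    have "2 * int p mod 8 = 6" using p4 by presburger
    then have odd_ab: "odd a \<and> odd b" using norm_5_mod_8[of a b] unfolding ab by simp
    show "theta 5 ((int p)\<^sup>2 * (24 * m + 6)) = - chi12 (int p * int p) * theta 5 (24 * m + 6)"
    proof (rule theta_split[OF pr(1,2) _ p5, of a b 2 "int p * (12 * m + 3)"])
      fix c d :: int
      \<comment> \<open>Here 4 divides the sum of the two products because a and b are odd, and 3
        their difference because 3 divides ab.\<close>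
      have "even (a\<^sup>2 - 5 * b\<^sup>2)" using odd_ab by simp
      then have "4 dvd 2 * (c * d) * (a\<^sup>2 - 5 * b\<^sup>2)"
        using mult_dvd_mono[of 2 "2 * (c * d)" 2 "a\<^sup>2 - 5 * b\<^sup>2"] by simp
      moreover have "\<not> 3 dvd a\<^sup>2 + 5 * b\<^sup>2" unfolding ab using not3 by presburger
      then have "3 dvd a * b" by (intro product_dvd_3_of_norm[of 5]) simp_all
      then have "3 dvd 2 * (a * b) * (c\<^sup>2 - 5 * d\<^sup>2)" by simp
      ultimately show "chi12 ((a * c - 5 * b * d) * (a * d + b * c)) = - chi12 ((a * c + 5 * b * d) * (a * d - b * c))"
        by (intro chi12_neg_right) (simp_all add: power2_eq_square algebra_simps)
    next
      fix x y :: int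
      assume "x\<^sup>2 + 5 * y\<^sup>2 = (int p)\<^sup>2 * (24 * m + 6)"
      \<comment> \<open>x and y have equal parity, so x + y sqrt(-5), like a + b sqrt(-5), lies in
        the prime above 2, whose square is (2).\<close>
      then have "even (x\<^sup>2 + 5 * y\<^sup>2)" by simp
      then show "2 dvd x * a + 5 * y * b \<and> 2 dvd y * a - x * b" using odd_ab by simp
    next
      show "coprime 2 (int p)" using pr(2) by simp
    qed (use ab in \<open>auto simp: algebra_simps\<close>)
  qed
qed

text \<open>A split \<open>p\<close> is a value of x^2 + 2 y^2, hence 1 or 3 modulo 8; the residues
  5 and 7 meet the inert case only.\<close>

lemma theta_2:
  assumes p: "prime p" "odd p" "p mod 8 \<noteq> 1"
  shows "theta 2 ((int p)\<^sup>2 * (24 * m + 3)) = - Kronecker (- 2) p * theta 2 (24 * m + 3)"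
proof (cases "p = 3")
  case True
  have "(24 * m + 3) mod 3 = 0" by presburger
  from theta_2_prime_3[OF this]
  have "theta 2 ((int p)\<^sup>2 * (24 * m + 3)) = - theta 2 (24 * m + 3)" using True by simp
  moreover have "\<exists>s. int p dvd s\<^sup>2 + 2" using True by (intro exI[of _ 1]) simp
  then have "Kronecker (- 2) p = 1" using True by (simp add: Kronecker_minus)
  ultimately show ?thesis by simp
next
  case False
  have "p \<noteq> 2" using p(2) by auto
  then have "\<not> int p dvd int 2"
    using p(1) primes_dvd_imp_eq[of p 2] unfolding int_dvd_int_iff by auto
  then have p2: "\<not> int p dvd 2" by simp
  note pr = prime_gt_3_facts[OF p(1) \<open>p \<noteq> 2\<close> False]
  have not3: "\<not> 3 dvd p" using primes_dvd_imp_eq[of 3 p] p(1) False by auto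
  show ?thesis
  proof (rule theta_Kronecker[OF p(1) \<open>p \<noteq> 2\<close> False p2])
    assume "\<exists>s. int p dvd s\<^sup>2 + 2"
    then obtain s where s: "int p dvd s\<^sup>2 + 2" ..
    from norm_form_2[OF p(1,2) s] obtain a b where ab: "a\<^sup>2 + 2 * b\<^sup>2 = int p" by blast
    have "odd a \<and> int p mod 8 = (if odd b then 3 else 1)"
      using norm_2_mod_8[of a b] pr(2) unfolding ab by simp
    moreover have "int p mod 8 \<noteq> 1" using p(3) by presburger
    ultimately have p8: "int p mod 8 = 3" by (auto split: if_splits)
    show "theta 2 ((int p)\<^sup>2 * (24 * m + 3)) = - chi12 (int p * int p) * theta 2 (24 * m + 3)"
    proof (rule theta_split[OF pr(1,2) _ p2, of a b 1 "int p * (24 * m + 3)"])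
      fix c d :: int
      assume cd: "c\<^sup>2 + 2 * d\<^sup>2 = int p * (24 * m + 3)"
      \<comment> \<open>The norm of c + d sqrt(-2) is 3 times 3, that is 1, modulo 8, so d is even
        and 4 divides the sum 2cd(a^2 - 2 b^2).\<close>
      have "(int p * (24 * m + 3)) mod 8 = ((int p mod 8) * ((24 * m + 3) mod 8)) mod 8"
        by (simp only: mod_mult_eq)
      also have "(24 * m + 3) mod 8 = 3" by presburger
      finally have "(int p * (24 * m + 3)) mod 8 = 1" using p8 by simp
      moreover have "odd (int p * (24 * m + 3))" using pr(2) by simp
      ultimately have "even d" using norm_2_mod_8[of c d] unfolding cd by (auto split: if_splits)
      then have "4 dvd 2 * (c * d) * (a\<^sup>2 - 2 * b\<^sup>2)"
        using mult_dvd_mono[of 2 2 2 "c * d"] by simp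
      moreover have "\<not> 3 dvd a\<^sup>2 + 2 * b\<^sup>2" unfolding ab using not3 by presburger
      then have "3 dvd a * b" by (intro product_dvd_3_of_norm[of 2]) simp_all
      then have "3 dvd 2 * (a * b) * (c\<^sup>2 - 2 * d\<^sup>2)" by simp
      ultimately show "chi12 ((a * c - 2 * b * d) * (a * d + b * c)) = - chi12 ((a * c + 2 * b * d) * (a * d - b * c))"
        by (intro chi12_neg_right) (simp_all add: power2_eq_square algebra_simps)
    qed (use ab in auto)
  qed
qed

subsection \<open>Bipartitions and representations\<close>

lemma chi12_six: "chi12 (6 * m + 1) = (-1) ^ nat \<bar>m\<bar>"
proof -
  have "(6 * m + 1) mod 3 = 1" by presburger
  moreover have "even m \<Longrightarrow> (6 * m + 1) mod 4 = 1" "odd m \<Longrightarrow> (6 * m + 1) mod 4 = 3" by presburger+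
  ultimately show ?thesis
    unfolding chi12_def chi3_def chi4_def by (cases "even m") (simp_all add: even_nat_iff)
qed

lemma chi12_signed:
  assumes "s \<in> {1, -1}"
  shows "chi12 (s * (6 * m + 1)) = (-1) ^ nat \<bar>m\<bar>"
proof -
  have "chi12 (s * (6 * m + 1)) = chi12 (6 * m + 1)"
    using assms chi12_minus[of "6 * m + 1"] by auto
  then show ?thesis by (simp only: chi12_six)
qed

text \<open>For x prime to 6, the sign s with s x = 1 modulo 6, so that x = s (6 m + 1) in exactly
  one way.\<close>

definition sign6 :: "int \<Rightarrow> int" where
  "sign6 x = (if x mod 6 = 1 then 1 else -1)"

lemma sign6_decomposition:
  assumes "odd x" "\<not> 3 dvd x"
  shows "sign6 x * (6 * ((sign6 x * x - 1) div 6) + 1) = x"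
proof -
  have "x mod 6 = 1 \<or> x mod 6 = 5" using assms by presburger
  then show ?thesis by (auto simp: sign6_def) presburger+
qed

lemma sign6_signed:
  assumes "s \<in> {1, -1}"
  shows "sign6 (s * (6 * m + 1)) = s" "(s * (s * (6 * m + 1)) - 1) div 6 = m"
proof -
  have "(6 * m + 1) mod 6 = 1" "(- 6 * m - 1) mod 6 = 5" by presburger+
  then show "sign6 (s * (6 * m + 1)) = s" using assms by (auto simp: sign6_def)
  show "(s * (s * (6 * m + 1)) - 1) div 6 = m" using assms by auto
qed

lemma norm_pent:
  fixes s t m l :: int
  assumes "s \<in> {1, -1}" "t \<in> {1, -1}"
  shows "(s * (6 * m + 1), t * (6 * l + 1)) \<in> reps (int v) (24 * int n + 1 + int v)
    \<longleftrightarrow> pent m + v * pent l = n"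
proof -
  have sq: "(s * (6 * m + 1))\<^sup>2 = 24 * int (pent m) + 1" if "s \<in> {1, -1}" for s m :: int
  proof -
    have "(s * (6 * m + 1))\<^sup>2 = 12 * (m * (3 * m + 1)) + 1"
      using that by (auto simp: power2_eq_square algebra_simps)
    then show ?thesis unfolding pent_double[symmetric] by simp
  qed
  have "(s * (6 * m + 1), t * (6 * l + 1)) \<in> reps (int v) (24 * int n + 1 + int v)
    \<longleftrightarrow> 24 * int (pent m + v * pent l) = 24 * int n"
    unfolding reps_def mem_Collect_eq prod.case sq[OF assms(1)] sq[OF assms(2)]
    by (auto simp: algebra_simps)
  also have "\<dots> \<longleftrightarrow> pent m + v * pent l = n"
    by (simp only: mult_cancel_left of_nat_eq_iff) simp
  finally show ?thesis .
qed

text \<open>The weight singles out coordinates prime to 6, each of the form s (6 m + 1). The two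
  free signs account for the factor 4, which is 1 modulo 3.\<close>

lemma theta_pentagonal:
  assumes "v > 0"
  shows "theta (int v) (24 * int n + 1 + int v) =
    4 * (\<Sum>(m, l)\<in>{(m, l). pent m + v * pent l = n}. (-1) ^ nat \<bar>m\<bar> * (-1) ^ nat \<bar>l\<bar>)"
proof -
  let ?R = "reps (int v) (24 * int n + 1 + int v)"
  let ?P = "{(m, l). pent m + v * pent l = n}"
  let ?S = "{1, -1 :: int} \<times> {1, -1 :: int}"
  let ?h = "\<lambda>((s :: int, t :: int), (m, l)). (-1) ^ nat \<bar>m\<bar> * (-1) ^ nat \<bar>l\<bar> :: int"
  let ?i = "\<lambda>((s :: int, t :: int), (m :: int, l :: int)). (s * (6 * m + 1), t * (6 * l + 1))"
  let ?j = "\<lambda>(x, y). ((sign6 x, sign6 y), ((sign6 x * x - 1) div 6, (sign6 y * y - 1) div 6))"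
  have "theta (int v) (24 * int n + 1 + int v) = (\<Sum>(x, y)\<in>{(x, y) \<in> ?R. chi12 (x * y) \<noteq> 0}. chi12 (x * y))"
    unfolding theta_def using assms by (intro sum.mono_neutral_right) (auto simp: finite_reps)
  also have "\<dots> = (\<Sum>((s, t), (m, l))\<in>?S \<times> ?P. (-1) ^ nat \<bar>m\<bar> * (-1) ^ nat \<bar>l\<bar>)"
  proof (rule sum.reindex_bij_witness[of _ ?i ?j])
    fix z assume z: "z \<in> {(x, y) \<in> ?R. chi12 (x * y) \<noteq> 0}"
    obtain x y where xy: "z = (x, y)" by fastforce
    let ?m = "(sign6 x * x - 1) div 6" and ?l = "(sign6 y * y - 1) div 6"
    have nz: "chi12 (x * y) \<noteq> 0" using z xy by simp
    then have x: "sign6 x * (6 * ?m + 1) = x" and y: "sign6 y * (6 * ?l + 1) = y"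
      by (auto intro!: sign6_decomposition simp: chi12_nonzero_iff)
    then show "?i (?j z) = z" by (simp only: xy prod.case)
    have s: "sign6 x \<in> {1, -1}" "sign6 y \<in> {1, -1}" by (simp_all add: sign6_def)
    have "(x, y) \<in> ?R" using z xy by simp
    then have "pent ?m + v * pent ?l = n"
      using norm_pent[OF s, of ?m ?l v n] unfolding x y by simp
    then show "?j z \<in> ?S \<times> ?P"
      using s unfolding xy prod.case by (intro SigmaI) simp_all
    have "chi12 (x * y) = chi12 (sign6 x * (6 * ?m + 1)) * chi12 (sign6 y * (6 * ?l + 1))"
      unfolding x y by (rule chi12_mult)
    then show "?h (?j z) = (case z of (x, y) \<Rightarrow> chi12 (x * y))"
      unfolding xy prod.case chi12_signed[OF s(1)] chi12_signed[OF s(2)] by (rule sym)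
  next
    fix z assume z: "z \<in> ?S \<times> ?P"
    then obtain s t m l where stml: "z = ((s, t), m, l)" and s: "s \<in> {1, -1}" and t: "t \<in> {1, -1}"
      and P: "pent m + v * pent l = n" by auto
    show "?j (?i z) = z"
      unfolding stml prod.case sign6_signed[OF s] sign6_signed[OF t] ..
    have "(s * (6 * m + 1), t * (6 * l + 1)) \<in> ?R"
      using P by (simp only: norm_pent[OF s t])
    moreover have "chi12 (s * (6 * m + 1) * (t * (6 * l + 1))) \<noteq> 0"
      unfolding chi12_mult[of "s * (6 * m + 1)"] chi12_signed[OF s] chi12_signed[OF t] by simp
    ultimately show "?i z \<in> {(x, y) \<in> ?R. chi12 (x * y) \<noteq> 0}"
      unfolding stml by simp
  qed
  also have "\<dots> = (\<Sum>st\<in>?S. \<Sum>(m, l)\<in>?P. (-1) ^ nat \<bar>m\<bar> * (-1) ^ nat \<bar>l\<bar>)"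
    unfolding sum.cartesian_product by (rule sum.cong) auto
  also have "\<dots> = 4 * (\<Sum>(m, l)\<in>?P. (-1) ^ nat \<bar>m\<bar> * (-1) ^ nat \<bar>l\<bar>)"
    by simp
  finally show ?thesis .
qed

lemma B3_theta:
  assumes "v > 0"
  shows "[int (B 3 v n) = theta (int v) (24 * int n + 1 + int v)] (mod 3)"
proof -
  have "[1 * z = 4 * z] (mod 3)" for z :: int
    by (rule cong_scalar_right) (simp add: cong_def)
  then show ?thesis
    unfolding theta_pentagonal[OF assms] using B3_pentagonal[OF assms, of n] by (auto intro: cong_trans)
qed

section \<open>Arithmetic of the arguments and conclusion\<close>

lemma argument_scaling:
  fixes c t p r n k :: nat
  assumes "c > 1" "t > 0" "p > 0" "k > 0" "[p = t] (mod c)" "[t * t = 1] (mod c)" "p dvd c * r + t"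
  shows "c * (p ^ (k + 1) * n + p * r + (t * p - 1) div c) + 1
    = p\<^sup>2 * (c * (p ^ (k - 1) * n + (c * r + t - p) div (c * p)) + 1)"
proof -
  from assms(7) obtain j where j: "c * r + t = p * j" by (rule dvdE)
  have tp: "[t * p = 1] (mod c)"
    using cong_scalar_left[OF assms(5), of t] assms(6) by (rule cong_trans)
  \<comment> \<open>\<open>t\<close> is inverse to \<open>p\<close> and to itself modulo
    \<open>c\<close>, so j = t (c r + t) = 1 modulo \<open>c\<close>. Hence the subtractions do not
    truncate and the divisions are exact.\<close>
  have "[j * 1 = j * (t * p)] (mod c)" by (rule cong_scalar_left[OF cong_sym[OF tp]])
  also have "j * (t * p) = t * (c * r + t)" unfolding j by simp
  also have "[t * (c * r + t) = t * t] (mod c)" by (simp add: cong_def algebra_simps)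
  also note assms(6)
  finally have "[j = 1] (mod c)" by simp
  then have "j mod c = 1" using assms(1) by (simp add: cong_def)
  then obtain i where i: "j = c * i + 1" by (metis mult_div_mod_eq)
  have "(t * p) mod c = 1" using tp assms(1) by (simp add: cong_def)
  then obtain u where u: "t * p = c * u + 1" by (metis mult_div_mod_eq)
  obtain q where q: "k = Suc q" using assms(4) by (cases k) auto
  have "(c * r + t - p) div (c * p) = i"
    using assms(1,3) unfolding j i by (simp add: algebra_simps)
  moreover have "(t * p - 1) div c = u" using assms(1) unfolding u by simp
  moreover have "c * (p * r) + (c * u + 1) = p * (p * (c * i + 1))"
    unfolding u[symmetric] i[symmetric] j[symmetric] by (simp add: algebra_simps)
  then have "c * (p ^ (k + 1) * n + p * r + u) + 1 = p\<^sup>2 * (c * (p ^ (k - 1) * n + i) + 1)"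
    unfolding q by (simp add: power2_eq_square algebra_simps)
  ultimately show ?thesis by (simp only:)
qed

text \<open>Since c w = 24, multiplying c N + 1 = p^2 (c M + 1) by w = v + 1 produces the arguments
  of \<open>theta\<close>.\<close>

lemma B3_scaling:
  assumes v: "v > 0" and w: "c * w = 24" "w = v + 1"
    and NM: "c * N + 1 = p\<^sup>2 * (c * M + 1)"
    and th: "\<And>m. theta (int v) ((int p)\<^sup>2 * (24 * m + int w)) = - K * theta (int v) (24 * m + int w)"
  shows "[int (B 3 v N) = - K * int (B 3 v M)] (mod 3)"
proof -
  have "w * (c * N + 1) = w * (p\<^sup>2 * (c * M + 1))" unfolding NM ..
  then have "(c * w) * N + w = p\<^sup>2 * ((c * w) * M + w)" by (simp add: algebra_simps)
  then have "int (24 * N + w) = int (p\<^sup>2 * (24 * M + w))" unfolding w(1) by (simp only:)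
  then have eq: "24 * int N + 1 + int v = (int p)\<^sup>2 * (24 * int M + int w)"
    using w(2) by (simp add: algebra_simps)
  have eq': "24 * int M + 1 + int v = 24 * int M + int w" using w(2) by simp
  have "[int (B 3 v N) = - K * theta (int v) (24 * int M + 1 + int v)] (mod 3)"
    using B3_theta[OF v, of N] unfolding eq eq' th .
  also have "[- K * theta (int v) (24 * int M + 1 + int v) = - K * int (B 3 v M)] (mod 3)"
    by (intro cong_scalar_left cong_sym[OF B3_theta[OF v]])
  finally show ?thesis .
qed

theorem theorem1p6:
  fixes k n :: nat
  assumes "k > 0" and "n > 0"
  shows
   "(\<forall>p r :: nat. prime p \<longrightarrow> [p = 2] (mod 3) \<longrightarrow> p dvd 3 * r + 2 \<longrightarrow>
       [int (B 3 7 (p ^ (k + 1) * n + p * r + (2 * p - 1) div 3)) =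
          - Kronecker (-7) p * int (B 3 7 (p ^ (k - 1) * n + (3 * r + 2 - p) div (3 * p)))] (mod 3))
    \<and>
    (\<forall>p r :: nat. prime p \<longrightarrow> [p = 3] (mod 4) \<longrightarrow> p dvd 4 * r + 3 \<longrightarrow>
       [int (B 3 5 (p ^ (k + 1) * n + p * r + (3 * p - 1) div 4)) =
          - Kronecker (-5) p * int (B 3 5 (p ^ (k - 1) * n + (4 * r + 3 - p) div (4 * p)))] (mod 3))
    \<and>
    (\<forall>t p r :: nat. t \<in> {3, 5, 7} \<longrightarrow> prime p \<longrightarrow> [p = t] (mod 8) \<longrightarrow> p dvd 8 * r + t \<longrightarrow>
       [int (B 3 2 (p ^ (k + 1) * n + p * r + (t * p - 1) div 8)) =
          - Kronecker (-2) p * int (B 3 2 (p ^ (k - 1) * n + (8 * r + t - p) div (8 * p)))] (mod 3))"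
proof (intro conjI allI impI)
  fix p r :: nat
  assume p: "prime p" "[p = 2] (mod 3)" "p dvd 3 * r + 2"
  have "p > 0" "p mod 3 = 2" using p by (simp_all add: prime_gt_0_nat cong_def)
  then show "[int (B 3 7 (p ^ (k + 1) * n + p * r + (2 * p - 1) div 3)) =
      - Kronecker (-7) p * int (B 3 7 (p ^ (k - 1) * n + (3 * r + 2 - p) div (3 * p)))] (mod 3)"
    using p assms(1) theta_7[of p]
    by (intro B3_scaling[where c = 3 and w = 8 and p = p] argument_scaling) (simp_all add: cong_def)
next
  fix p r :: nat
  assume p: "prime p" "[p = 3] (mod 4)" "p dvd 4 * r + 3"
  have "p > 0" "p mod 4 = 3" using p by (simp_all add: prime_gt_0_nat cong_def)
  then show "[int (B 3 5 (p ^ (k + 1) * n + p * r + (3 * p - 1) div 4)) =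
      - Kronecker (-5) p * int (B 3 5 (p ^ (k - 1) * n + (4 * r + 3 - p) div (4 * p)))] (mod 3)"
    using p assms(1) theta_5[of p]
    by (intro B3_scaling[where c = 4 and w = 6 and p = p] argument_scaling) (simp_all add: cong_def)
next
  fix t p r :: nat
  assume t: "t \<in> {3, 5, 7}" and p: "prime p" "[p = t] (mod 8)" "p dvd 8 * r + t"
  have "p > 0" "p mod 8 = t" using p t by (auto simp: prime_gt_0_nat cong_def)
  moreover from this have "odd p" "p mod 8 \<noteq> 1" using t by (auto; presburger)+
  moreover have "[t * t = 1] (mod 8)" "t > 0" using t by (auto simp: cong_def)
  ultimately show "[int (B 3 2 (p ^ (k + 1) * n + p * r + (t * p - 1) div 8)) =
      - Kronecker (-2) p * int (B 3 2 (p ^ (k - 1) * n + (8 * r + t - p) div (8 * p)))] (mod 3)"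
    using p assms(1) theta_2[of p]
    by (intro B3_scaling[where c = 8 and w = 3 and p = p] argument_scaling) simp_all
qed

end
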